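(* Let $\Omega\subset\mathbb{R}^d$, $d\in\mathbb{N}$, be a bounded domain, let $c\in L^\infty(\Omega)$ with $c\ge 0$, and let $u\in H^1(\Omega)$ satisfy $$\int_\Omega \nabla u\cdot\nabla v+c\,u\,v\,\mathrm{d}x\le 0\qquad\text{for all } v\in H^1_0(\Omega)\text{ with } v\ge 0\text{ in }\Omega.$$ Let $U\in H^1(\Omega)$ be such that $U-u\in H^1_0(\Omega)$ (i.e. $u=U$ on $\partial\Omega$), and let $$U^*:=\min\Big\{U,\ \sup_{\partial\Omega}U^+\Big\}\in H^1(\Omega),\qquad U^+:=\max\{0,U\}.$$ Then $$|||u-U^*|||\le|||u-U|||,$$ where $|||\cdot|||$ is the energy norm on $H^1_0(\Omega)$ given by $|||v|||^2:=\int_\Omega|\nabla v|^2+c\,|v|^2\,\mathrm{d}x$.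
   Context: $H^1(\Omega)$ is the Sobolev space of (real-valued) square integrable functions with square integrable weak gradient; $H^1_0(\Omega)$ is its subspace of functions with vanishing trace on $\partial\Omega$ (the closure of $C_c^\infty(\Omega)$ in $H^1(\Omega)$). Boundary suprema are understood in the Sobolev (trace) sense: $\sup_{\partial\Omega}U^+:=\inf\{\ell\in\mathbb{R}:(U^+-\ell)^+\in H^1_0(\Omega)\}$, with value $+\infty$ if no such $\ell$ exists, in which case $U^*=U$. Here $w^+=\max\{0,w\}$. Inequalities between functions hold almost everywhere in $\Omega$. *)

theory Defs
  imports "HOL-Analysis.Analysis"
begin

primrec C_k :: "nat \<Rightarrow> ('a::euclidean_space \<Rightarrow> real) \<Rightarrow> bool" where
  "C_k 0 f \<longleftrightarrow> continuous_on UNIV f"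
| "C_k (Suc k) f \<longleftrightarrow> (\<forall>x. f differentiable (at x)) \<and>
     (\<forall>i\<in>Basis. C_k k (\<lambda>x. frechet_derivative f (at x) i))"

text \<open>\<open>C\<^sub>c\<^sup>\<infinity>(\<Omega>)\<close>, its elements being extended by zero to the whole space.\<close>

definition test_functions :: "'a::euclidean_space set \<Rightarrow> ('a \<Rightarrow> real) set" where
  "test_functions \<Omega> = {\<phi>. (\<forall>k. C_k k \<phi>) \<and>
     compact (closure {x. \<phi> x \<noteq> 0}) \<and> closure {x. \<phi> x \<noteq> 0} \<subseteq> \<Omega>}"

text \<open>
  In the function spaces below, an element is represented by any of its representatives on
  \<open>\<Omega>\<close>; the values outside \<open>\<Omega>\<close> are irrelevant, and no quotient by
  equality almost everywhere is taken.
\<close>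

definition L2 :: "'a::euclidean_space set \<Rightarrow> ('a \<Rightarrow> 'b::euclidean_space) set" where
  "L2 \<Omega> = {f. f \<in> borel_measurable (lebesgue_on \<Omega>) \<and>
     integrable (lebesgue_on \<Omega>) (\<lambda>x. (norm (f x))\<^sup>2)}"

definition Linfty :: "'a::euclidean_space set \<Rightarrow> ('a \<Rightarrow> real) set" where
  "Linfty \<Omega> = {f. f \<in> borel_measurable (lebesgue_on \<Omega>) \<and>
     (\<exists>M. AE x in lebesgue_on \<Omega>. \<bar>f x\<bar> \<le> M)}"

text \<open>The square integrable weak gradients of \<open>u\<close>.\<close>

definition has_weak_gradient ::
  "'a::euclidean_space set \<Rightarrow> ('a \<Rightarrow> real) \<Rightarrow> ('a \<Rightarrow> 'a) \<Rightarrow> bool" where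
  "has_weak_gradient \<Omega> u g \<longleftrightarrow> g \<in> L2 \<Omega> \<and>
     (\<forall>\<phi>\<in>test_functions \<Omega>. \<forall>i\<in>Basis.
        (LINT x|lebesgue_on \<Omega>. u x * frechet_derivative \<phi> (at x) i) =
        - (LINT x|lebesgue_on \<Omega>. (g x \<bullet> i) * \<phi> x))"

definition H1 :: "'a::euclidean_space set \<Rightarrow> ('a \<Rightarrow> real) set" where
  "H1 \<Omega> = {u. u \<in> L2 \<Omega> \<and> (\<exists>g. has_weak_gradient \<Omega> u g)}"

text \<open>
  A choice of a representative: for \<open>u \<in> H1 \<Omega>\<close> with \<open>\<Omega>\<close> open, the weak gradient
  is unique up to equality almost everywhere in \<open>\<Omega>\<close>.
\<close>

definition weak_grad :: "'a::euclidean_space set \<Rightarrow> ('a \<Rightarrow> real) \<Rightarrow> 'a \<Rightarrow> 'a" where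
  "weak_grad \<Omega> u = (SOME g. has_weak_gradient \<Omega> u g)"

definition H1_norm :: "'a::euclidean_space set \<Rightarrow> ('a \<Rightarrow> real) \<Rightarrow> real" where
  "H1_norm \<Omega> u = sqrt (LINT x|lebesgue_on \<Omega>. \<bar>u x\<bar>\<^sup>2 + (norm (weak_grad \<Omega> u x))\<^sup>2)"

definition H10 :: "'a::euclidean_space set \<Rightarrow> ('a \<Rightarrow> real) set" where
  "H10 \<Omega> = {u \<in> H1 \<Omega>. \<forall>\<epsilon>>0. \<exists>\<phi>\<in>test_functions \<Omega>. H1_norm \<Omega> (\<lambda>x. u x - \<phi> x) < \<epsilon>}"

text \<open>The infimum is taken in the extended reals, so that it is \<open>\<infinity>\<close> if no level is admissible.\<close>

definition boundary_sup :: "'a::euclidean_space set \<Rightarrow> ('a \<Rightarrow> real) \<Rightarrow> ereal" where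
  "boundary_sup \<Omega> w = Inf (ereal ` {l. (\<lambda>x. max 0 (w x - l)) \<in> H10 \<Omega>})"

text \<open>
  \<open>min {U, sup U\<^sup>+}\<close>, the supremum being over the boundary. For nonempty bounded open
  \<open>\<Omega>\<close> the supremum lies in \<open>[0, \<infinity>]\<close>, so the minimum is finite
  (and equal to \<open>U x\<close> if the supremum is \<open>\<infinity>\<close>), and \<open>real_of_ereal\<close> loses nothing.
\<close>

definition truncation :: "'a::euclidean_space set \<Rightarrow> ('a \<Rightarrow> real) \<Rightarrow> 'a \<Rightarrow> real" where
  "truncation \<Omega> U x = real_of_ereal (min (ereal (U x)) (boundary_sup \<Omega> (\<lambda>y. max 0 (U y))))"

definition energy_norm ::
  "'a::euclidean_space set \<Rightarrow> ('a \<Rightarrow> real) \<Rightarrow> ('a \<Rightarrow> real) \<Rightarrow> real" where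
  "energy_norm \<Omega> c v =
     sqrt (LINT x|lebesgue_on \<Omega>. (norm (weak_grad \<Omega> v x))\<^sup>2 + c x * \<bar>v x\<bar>\<^sup>2)"

end

theory Submission
  imports Defs
begin

text \<open>
  If the supremum \<open>M\<close> of \<open>U\<^sup>+\<close> over the boundary is infinite, the truncation is \<open>U\<close>.
  Otherwise let \<open>w = (U - M)\<^sup>+\<close>, so that the truncation is \<open>U - w\<close>. Once \<open>w\<close> is known to be
  in \<open>H\<^sub>0\<^sup>1\<close>, it may be used in the subsolution inequality. The gradient of \<open>w\<close> is
  \<open>1{U > M}\<close> times that of \<open>U\<close>, hence orthogonal to the gradient of \<open>U - w\<close>, while
  \<open>(U - w) w = M w \<ge> 0\<close> because \<open>M \<ge> 0\<close>. Expanding the square of the energy norm of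
  \<open>u - U = (u - (U - w)) - w\<close> then gives the estimate (\<open>energy_norm_truncate_le\<close>).

  That \<open>w\<close> is in \<open>H\<^sub>0\<^sup>1\<close> follows by letting the admissible levels decrease to \<open>M\<close>
  (\<open>positive_part_H10_limit\<close>). A negative level is never admissible, since a function in
  \<open>H\<^sub>0\<^sup>1\<close> of a nonempty bounded open set is not bounded below by a positive constant
  (\<open>H10_not_bounded_below\<close>).

  The analytic core is the formula for the weak gradient of a positive part,
  \<open>has_weak_gradient_positive_part\<close>. It is proved without mollification. The integrals of a weakly
  differentiable function against the translates of a test function are differentiable in the
  translation, and so are, since test functions are dense in \<open>L\<^sup>2\<close> (\<open>test_functions_dense\<close>), those
  against the translates of any square integrable function that vanishes outside an open set whose
  small translates stay in the domain (\<open>translation_derivative_L2\<close>). The subgradient inequality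
  for the positive part then compares two such integrals, which must have the same derivative at the origin. Density also yields
  the uniqueness of weak gradients (\<open>weak_gradient_unique\<close>), by which the chosen representative
  \<open>weak_grad\<close> can be replaced by any other one.
\<close>

section \<open>Smooth functions\<close>

lemma C_k_SucD: "C_k (Suc k) f \<Longrightarrow> C_k k f"
proof (induction k arbitrary: f)
  case 0
  then show ?case
    by (auto intro!: differentiable_imp_continuous_on simp: differentiable_on_def differentiable_at_withinI)
next
  case (Suc k)
  then show ?case by (metis C_k.simps(2))
qed

lemma C_k_const: "C_k k (\<lambda>x. c)"
  by (induction k arbitrary: c) auto

lemma C_k_SucI:
  assumes "\<And>x. (f has_derivative f' x) (at x)" "\<And>i. i \<in> Basis \<Longrightarrow> C_k k (\<lambda>x. f' x i)"
  shows "C_k (Suc k) f"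
proof -
  have "frechet_derivative f (at x) = f' x" for x
    using frechet_derivative_at[OF assms(1)] by simp
  then show ?thesis using assms by (auto simp: differentiable_def)
qed

lemma C_k_SucE:
  assumes "C_k (Suc k) f"
  shows "(f has_derivative frechet_derivative f (at x)) (at x)"
    and "i \<in> Basis \<Longrightarrow> C_k k (\<lambda>x. frechet_derivative f (at x) i)"
  using assms frechet_derivative_works[of f "at x"] by simp_all

lemma C_k_add: "C_k k f \<Longrightarrow> C_k k g \<Longrightarrow> C_k k (\<lambda>x. f x + g x)"
proof (induction k arbitrary: f g)
  case 0
  then show ?case by (simp add: continuous_on_add)
next
  case (Suc k)
  show ?case
    by (rule C_k_SucI[OF has_derivative_add[OF C_k_SucE(1)[OF Suc.prems(1)] C_k_SucE(1)[OF Suc.prems(2)]]])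
       (rule Suc.IH[OF C_k_SucE(2)[OF Suc.prems(1)] C_k_SucE(2)[OF Suc.prems(2)]])
qed

lemma C_k_mult: "C_k k f \<Longrightarrow> C_k k g \<Longrightarrow> C_k k (\<lambda>x. f x * g x)"
proof (induction k arbitrary: f g)
  case 0
  then show ?case by (simp add: continuous_on_mult)
next
  case (Suc k)
  show ?case
    by (rule C_k_SucI[OF has_derivative_mult[OF C_k_SucE(1)[OF Suc.prems(1)] C_k_SucE(1)[OF Suc.prems(2)]]])
       (rule C_k_add[OF
         Suc.IH[OF C_k_SucD[OF Suc.prems(1)] C_k_SucE(2)[OF Suc.prems(2)]]
         Suc.IH[OF C_k_SucE(2)[OF Suc.prems(1)] C_k_SucD[OF Suc.prems(2)]]])
qed

lemma C_k_diff: "C_k k f \<Longrightarrow> C_k k g \<Longrightarrow> C_k k (\<lambda>x. f x - g x)"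
  using C_k_add[OF _ C_k_mult[OF C_k_const[of k "-1"]], of f g] by simp

lemma C_k_sum: "(\<And>j. j \<in> J \<Longrightarrow> C_k k (f j)) \<Longrightarrow> C_k k (\<lambda>x. \<Sum>j\<in>J. f j x)"
  by (induction J rule: infinite_finite_induct) (auto intro: C_k_const C_k_add)

lemma C_k_inner: "C_k k (\<lambda>x. x \<bullet> a)"
proof (cases k)
  case (Suc m)
  have "C_k (Suc m) (\<lambda>x. x \<bullet> a)"
    by (rule C_k_SucI[OF bounded_linear_imp_has_derivative[OF bounded_linear_inner_left] C_k_const])
  with Suc show ?thesis by simp
qed (auto intro: continuous_intros)

lemma C_k_translate: "C_k k f \<Longrightarrow> C_k k (\<lambda>x. f (x - a))"
proof (induction k arbitrary: f)
  case 0
  then show ?case by (auto intro!: continuous_on_compose2[of UNIV f] continuous_intros)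
next
  case (Suc k)
  show ?case
  proof (rule C_k_SucI)
    have "((\<lambda>x. x - a) has_derivative (\<lambda>h. h)) (at x)" for x
      using has_derivative_diff[OF has_derivative_ident has_derivative_const] by simp
    then show "((\<lambda>x. f (x - a)) has_derivative frechet_derivative f (at (x - a))) (at x)" for x
      by (rule has_derivative_compose[OF _ C_k_SucE(1)[OF Suc.prems]])
    show "C_k k (\<lambda>x. frechet_derivative f (at (x - a)) i)" if "i \<in> Basis" for i
      by (rule Suc.IH[OF C_k_SucE(2)[OF Suc.prems that]])
  qed
qed

text \<open>The chain rule: \<open>h\<close> enumerates the successive derivatives of a smooth function of one
  real variable.\<close>

lemma C_k_compose:
  fixes h :: "nat \<Rightarrow> real \<Rightarrow> real"
  assumes h: "\<And>j t. (h j has_real_derivative h (Suc j) t) (at t)"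
  shows "C_k k f \<Longrightarrow> C_k k (\<lambda>x. h j (f x))"
proof (induction k arbitrary: j)
  case 0
  have "continuous_on UNIV (h j)"
    using h[of j] DERIV_isCont continuous_at_imp_continuous_on by blast
  with 0 show ?case by (auto intro!: continuous_on_compose2[of UNIV "h j"])
next
  case (Suc k)
  show ?case
  proof (rule C_k_SucI)
    show "((\<lambda>x. h j (f x)) has_derivative
        (\<lambda>v. h (Suc j) (f x) * frechet_derivative f (at x) v)) (at x)" for x
      by (rule has_derivative_compose[OF C_k_SucE(1)[OF Suc.prems]
            h[of j, THEN has_field_derivative_imp_has_derivative]])
    show "C_k k (\<lambda>x. h (Suc j) (f x) * frechet_derivative f (at x) i)" if "i \<in> Basis" for i
      by (intro C_k_mult Suc.IH C_k_SucD[OF Suc.prems] C_k_SucE(2)[OF Suc.prems that])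
  qed
qed

text \<open>
  The function \<open>p(1/t) exp(-1/t)\<close>, extended by zero to \<open>t \<le> 0\<close>. The derivative of
  such a function is of the same form, so it is smooth.
\<close>

definition flat :: "real poly \<Rightarrow> real \<Rightarrow> real" where
  "flat p t = (if t > 0 then poly p (1 / t) * exp (- (1 / t)) else 0)"

lemma flat_le_0 [simp]: "t \<le> 0 \<Longrightarrow> flat p t = 0"
  by (simp add: flat_def)

lemma poly_exp_decay: "((\<lambda>s. poly p s * exp (- s)) \<longlongrightarrow> (0::real)) at_top"
proof -
  have "((\<lambda>s. s ^ n * exp (- s)) \<longlongrightarrow> (0::real)) at_top" for n
    using tendsto_power_div_exp_0[of n] by (simp add: exp_minus field_simps)
  then have "((\<lambda>s. \<Sum>i\<le>degree p. coeff p i * (s ^ i * exp (- s))) \<longlongrightarrow>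
      (\<Sum>i\<le>degree p. coeff p i * 0)) at_top"
    by (intro tendsto_sum tendsto_mult tendsto_const)
  then show ?thesis by (simp add: poly_altdef sum_distrib_right mult.assoc)
qed

text \<open>For \<open>t > 0\<close> this is \<open>(p(1/t) exp(-1/t))' = (1/t)\<^sup>2 (p(1/t) - p'(1/t)) exp(-1/t)\<close>.\<close>

lemma flat_has_derivative:
  "(flat p has_real_derivative flat ([:0, 0, 1:] * (p - pderiv p)) t) (at t)"
proof -
  consider "t > 0" | "t < 0" | "t = 0" by linarith
  then show ?thesis
  proof cases
    case 1
    then have ev: "\<forall>\<^sub>F s in nhds t. flat p s = poly p (1 / s) * exp (- (1 / s))"
      using eventually_nhds_in_open[of "{0<..}" t] by (auto elim!: eventually_mono simp: flat_def)
    have "((\<lambda>s. poly p (1 / s) * exp (- (1 / s))) has_real_derivative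
        flat ([:0, 0, 1:] * (p - pderiv p)) t) (at t)"
      using 1
      by (auto intro!: derivative_eq_intros DERIV_chain2[where f = "poly p", OF poly_DERIV]
          simp: flat_def field_simps power2_eq_square)
    then show ?thesis
      by (subst DERIV_cong_ev[OF refl ev refl])
  next
    case 2
    then have "\<forall>\<^sub>F s in nhds t. flat p s = 0"
      using eventually_nhds_in_open[of "{..<0}" t] by (auto elim!: eventually_mono simp: flat_def)
    then show ?thesis using 2 by (subst DERIV_cong_ev[OF refl _ refl]) auto
  next
    case 3
    have "((\<lambda>s. poly (pCons 0 p) s * exp (- s)) \<longlongrightarrow> 0) at_top" by (rule poly_exp_decay)
    then have "((\<lambda>h. poly (pCons 0 p) (inverse h) * exp (- inverse h)) \<longlongrightarrow> 0) (at_right 0)"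
      by (rule filterlim_compose[OF _ filterlim_inverse_at_top_right])
    then have "((\<lambda>h. flat p h / h) \<longlongrightarrow> 0) (at_right 0)"
      by (rule Lim_transform_eventually)
         (auto intro!: eventually_at_rightI[of 0 1] simp: flat_def field_simps)
    moreover have "((\<lambda>h. flat p h / h) \<longlongrightarrow> 0) (at_left 0)"
      by (rule Lim_transform_eventually[OF tendsto_const])
         (auto intro!: eventually_at_leftI[of "-1"])
    ultimately have "((\<lambda>h. flat p h / h) \<longlongrightarrow> 0) (at 0)"
      by (simp add: filterlim_at_split)
    then show ?thesis using 3 by (simp add: DERIV_def)
  qed
qed

lemma C_k_flat: "C_k k f \<Longrightarrow> C_k k (\<lambda>x. flat [:1:] (f x))"
  using C_k_compose[where h = "\<lambda>j. flat (((\<lambda>p. [:0, 0, 1:] * (p - pderiv p)) ^^ j) [:1:])" and j = 0]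
    flat_has_derivative by simp

lemma C_k_exp: "C_k k f \<Longrightarrow> C_k k (\<lambda>x. exp (f x))"
  using C_k_compose[where h = "\<lambda>j. exp" and j = 0] by (simp add: DERIV_exp)

text \<open>A smooth function that, for \<open>r > 0\<close>, is positive exactly in the ball of radius \<open>r\<close> about
  \<open>z\<close>.\<close>

definition bump :: "'a::euclidean_space \<Rightarrow> real \<Rightarrow> 'a \<Rightarrow> real" where
  "bump z r x = flat [:1:] (r\<^sup>2 - (x - z) \<bullet> (x - z))"

lemma C_k_bump: "C_k k (bump z r)"
proof -
  have "C_k k (\<lambda>x::'a. r\<^sup>2 - (\<Sum>i\<in>Basis. (x \<bullet> i) * (x \<bullet> i)))"
    by (intro C_k_diff C_k_const C_k_sum C_k_mult C_k_inner)
  then have "C_k k (\<lambda>x::'a. flat [:1:] (r\<^sup>2 - x \<bullet> x))"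
    by (intro C_k_flat) (simp add: euclidean_inner[symmetric])
  from C_k_translate[OF this, of z] show ?thesis
    by (simp add: bump_def[abs_def])
qed

lemma bump_nonneg: "0 \<le> bump z r x"
  by (simp add: bump_def flat_def)

lemma bump_pos_iff: "r > 0 \<Longrightarrow> 0 < bump z r x \<longleftrightarrow> dist x z < r"
  using norm_lt_square[of "x - z" r] by (simp add: bump_def flat_def dist_norm)

section \<open>Test functions\<close>

lemma test_functionsI:
  assumes "\<And>k. C_k k \<phi>" "compact K" "K \<subseteq> \<Omega>" "\<And>x. x \<notin> K \<Longrightarrow> \<phi> x = 0"
  shows "\<phi> \<in> test_functions \<Omega>"
proof -
  have "closure {x. \<phi> x \<noteq> 0} \<subseteq> K"
    using assms by (intro closure_minimal compact_imp_closed) auto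
  moreover from this have "compact (closure {x. \<phi> x \<noteq> 0})"
    using compact_Int_closed[OF assms(2) closed_closure, of "{x. \<phi> x \<noteq> 0}"] by (simp add: Int_absorb1)
  ultimately show ?thesis
    using assms(1,3) by (simp add: test_functions_def)
qed

lemma test_functionsE:
  assumes "\<phi> \<in> test_functions \<Omega>"
  obtains K where "compact K" "K \<subseteq> \<Omega>" "\<And>x. x \<notin> K \<Longrightarrow> \<phi> x = 0"
proof
  show "compact (closure {x. \<phi> x \<noteq> 0})" "closure {x. \<phi> x \<noteq> 0} \<subseteq> \<Omega>"
    using assms by (simp_all add: test_functions_def)
  show "\<phi> x = 0" if "x \<notin> closure {x. \<phi> x \<noteq> 0}" for x
    using that closure_subset[of "{x. \<phi> x \<noteq> 0}"] by blast
qed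

lemma test_functions_C_k: "\<phi> \<in> test_functions \<Omega> \<Longrightarrow> C_k k \<phi>"
  by (simp add: test_functions_def)

lemma test_functions_mono: "\<Omega> \<subseteq> \<Omega>' \<Longrightarrow> test_functions \<Omega> \<subseteq> test_functions \<Omega>'"
  by (auto simp: test_functions_def)

lemma test_function_continuous: "\<phi> \<in> test_functions \<Omega> \<Longrightarrow> continuous_on S \<phi>"
  using test_functions_C_k[of \<phi> \<Omega> 0] by (auto intro: continuous_on_subset)

lemma test_function_outside: "\<phi> \<in> test_functions \<Omega> \<Longrightarrow> x \<notin> \<Omega> \<Longrightarrow> \<phi> x = 0"
  by (metis test_functionsE subsetD)

lemma test_function_has_derivative:
  "\<phi> \<in> test_functions \<Omega> \<Longrightarrow> (\<phi> has_derivative frechet_derivative \<phi> (at x)) (at x)"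
  by (rule C_k_SucE(1)[OF test_functions_C_k])

lemma test_function_zero: "(\<lambda>x. 0) \<in> test_functions \<Omega>"
  by (rule test_functionsI[of _ "{}"]) (auto intro: C_k_const)

lemma test_function_add:
  assumes "\<phi> \<in> test_functions \<Omega>" "\<psi> \<in> test_functions \<Omega>"
  shows "(\<lambda>x. \<phi> x + \<psi> x) \<in> test_functions \<Omega>"
proof -
  obtain K K' where "compact K" "K \<subseteq> \<Omega>" "\<And>x. x \<notin> K \<Longrightarrow> \<phi> x = 0"
    "compact K'" "K' \<subseteq> \<Omega>" "\<And>x. x \<notin> K' \<Longrightarrow> \<psi> x = 0"
    using assms by (meson test_functionsE)
  then show ?thesis
    by (intro test_functionsI[where K = "K \<union> K'"] C_k_add assms[THEN test_functions_C_k]) auto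
qed

lemma test_function_mult:
  assumes "\<And>k. C_k k f" "\<phi> \<in> test_functions \<Omega>"
  shows "(\<lambda>x. f x * \<phi> x) \<in> test_functions \<Omega>"
proof -
  obtain K where "compact K" "K \<subseteq> \<Omega>" "\<And>x. x \<notin> K \<Longrightarrow> \<phi> x = 0"
    using assms by (meson test_functionsE)
  then show ?thesis
    by (intro test_functionsI[where K = K] C_k_mult assms test_functions_C_k[OF assms(2)]) auto
qed

lemma test_function_scale:
  "\<phi> \<in> test_functions \<Omega> \<Longrightarrow> (\<lambda>x. c * \<phi> x) \<in> test_functions \<Omega>"
  by (intro test_function_mult C_k_const)

lemma test_function_partial:
  assumes "\<phi> \<in> test_functions \<Omega>" "i \<in> Basis"
  shows "(\<lambda>x. frechet_derivative \<phi> (at x) i) \<in> test_functions \<Omega>"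
proof -
  obtain K where K: "compact K" "K \<subseteq> \<Omega>" "\<And>x. x \<notin> K \<Longrightarrow> \<phi> x = 0"
    using assms by (meson test_functionsE)
  have "frechet_derivative \<phi> (at x) = (\<lambda>h. 0)" if "x \<notin> K" for x
  proof -
    have "open (- K)" using K compact_imp_closed by auto
    then have "(\<phi> has_derivative (\<lambda>h. 0)) (at x)"
      using that K by (intro has_derivative_transform_within_open[OF has_derivative_const \<open>open (- K)\<close>]) auto
    then show ?thesis by (rule frechet_derivative_at[symmetric])
  qed
  with K show ?thesis
    by (intro test_functionsI[where K = K] C_k_SucE(2)[OF test_functions_C_k[OF assms(1)] assms(2)]) auto
qed

lemma test_function_translate:
  assumes "\<phi> \<in> test_functions V" "\<And>x. x \<in> V \<Longrightarrow> x + a \<in> \<Omega>"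
  shows "(\<lambda>x. \<phi> (x - a)) \<in> test_functions \<Omega>"
proof -
  obtain K where K: "compact K" "K \<subseteq> V" "\<And>x. x \<notin> K \<Longrightarrow> \<phi> x = 0"
    using assms by (meson test_functionsE)
  have "x - a \<notin> K" if "x \<notin> (\<lambda>x. a + x) ` K" for x
    using that by (metis add.commute diff_add_cancel image_eqI)
  with K assms(2) show ?thesis
    by (intro test_functionsI[where K = "(\<lambda>x. a + x) ` K"] C_k_translate[OF test_functions_C_k[OF assms(1)]]
         compact_translation) (auto simp: add.commute)
qed

lemma test_function_bounded:
  assumes "\<phi> \<in> test_functions \<Omega>"
  obtains B where "0 < B" "\<And>x. \<bar>\<phi> x\<bar> \<le> B"
proof -
  obtain K where K: "compact K" "K \<subseteq> \<Omega>" "\<And>x. x \<notin> K \<Longrightarrow> \<phi> x = 0"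
    using assms by (meson test_functionsE)
  have "bounded (\<phi> ` K)"
    using K(1) test_function_continuous[OF assms] compact_continuous_image compact_imp_bounded by blast
  then obtain B where "0 < B" "\<And>x. x \<in> K \<Longrightarrow> \<bar>\<phi> x\<bar> \<le> B"
    by (auto simp: bounded_pos)
  then show thesis using that K(3) by (metis abs_zero less_imp_le)
qed

text \<open>Every compact subset of an open set is contained in the positivity set of a nonnegative
  test function.\<close>

lemma positive_test_function:
  assumes "compact K" "open V" "K \<subseteq> V"
  obtains s where "s \<in> test_functions V" "\<And>x. 0 \<le> s x" "\<And>x. x \<in> K \<Longrightarrow> 0 < s x"
proof -
  obtain e where e: "e > 0" "(\<Union>x\<in>K. cball x e) \<subseteq> V"
    using compact_subset_open_imp_cball_epsilon_subset[OF assms] by blast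
  have "K \<subseteq> \<Union>((\<lambda>z. ball z e) ` K)" using e by auto
  then obtain F where F: "F \<subseteq> K" "finite F" "K \<subseteq> (\<Union>z\<in>F. ball z e)"
    using compactE_image[OF \<open>compact K\<close>, of K "\<lambda>z. ball z e"] by auto
  let ?s = "\<lambda>x. \<Sum>z\<in>F. bump z e x"
  show thesis
  proof
    have zero: "bump z e x = 0" if "z \<in> F" "x \<notin> (\<Union>z\<in>F. cball z e)" for x z
    proof -
      have "\<not> dist x z < e" using that by (force simp: dist_commute)
      then show ?thesis using bump_pos_iff[OF e(1)] bump_nonneg[of z e x] by force
    qed
    show "?s \<in> test_functions V"
      using e F zero
      by (intro test_functionsI[where K = "\<Union>z\<in>F. cball z e"] C_k_sum C_k_bump compact_UN sum.neutral)
         auto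
    show "0 \<le> ?s x" for x by (intro sum_nonneg bump_nonneg)
    show "0 < ?s x" if x: "x \<in> K" for x
    proof -
      obtain z where "z \<in> F" "dist x z < e" using F x by (auto simp: dist_commute)
      then show ?thesis
        using F(2) bump_pos_iff[OF e(1)] bump_nonneg by (intro sum_pos2[of F z]) auto
    qed
  qed
qed

section \<open>Square integrable functions\<close>

lemma L2_measurable: "f \<in> L2 \<Omega> \<Longrightarrow> f \<in> borel_measurable (lebesgue_on \<Omega>)"
  and L2_integrable: "f \<in> L2 \<Omega> \<Longrightarrow> integrable (lebesgue_on \<Omega>) (\<lambda>x. (norm (f x))\<^sup>2)"
  by (auto simp: L2_def)

lemma L2_inner_integrable:
  assumes "f \<in> L2 \<Omega>" "g \<in> L2 \<Omega>"
  shows "integrable (lebesgue_on \<Omega>) (\<lambda>x. f x \<bullet> g x)"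
proof (rule Bochner_Integration.integrable_bound)
  show "integrable (lebesgue_on \<Omega>) (\<lambda>x. (norm (f x))\<^sup>2 + (norm (g x))\<^sup>2)"
    using assms by (intro Bochner_Integration.integrable_add L2_integrable)
  show "(\<lambda>x. f x \<bullet> g x) \<in> borel_measurable (lebesgue_on \<Omega>)"
    using assms by (intro borel_measurable_inner L2_measurable)
  have "norm (a \<bullet> b) \<le> norm ((norm a)\<^sup>2 + (norm b)\<^sup>2)" for a b :: 'b
  proof -
    have "norm (a \<bullet> b) \<le> norm a * norm b" by (simp add: Cauchy_Schwarz_ineq2)
    also have "\<dots> \<le> (norm a)\<^sup>2 + (norm b)\<^sup>2"
    proof -
      have "2 * (norm a * norm b) \<le> (norm a)\<^sup>2 + (norm b)\<^sup>2"
        using sum_squares_bound[of "norm a" "norm b"] by (simp add: mult.assoc)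
      moreover have "0 \<le> norm a * norm b" by simp
      ultimately show ?thesis by linarith
    qed
    finally show ?thesis by simp
  qed
  then show "AE x in lebesgue_on \<Omega>. norm (f x \<bullet> g x) \<le> norm ((norm (f x))\<^sup>2 + (norm (g x))\<^sup>2)"
    by simp
qed

lemma L2_mult_integrable:
  fixes f g :: "'a::euclidean_space \<Rightarrow> real"
  shows "f \<in> L2 \<Omega> \<Longrightarrow> g \<in> L2 \<Omega> \<Longrightarrow> integrable (lebesgue_on \<Omega>) (\<lambda>x. f x * g x)"
  using L2_inner_integrable[of f \<Omega> g] by (simp add: inner_real_def)

lemma L2_bounded_mult:
  fixes h :: "'a::euclidean_space \<Rightarrow> real"
  assumes f: "f \<in> L2 \<Omega>" and h: "h \<in> borel_measurable (lebesgue_on \<Omega>)"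
    and bd: "AE x in lebesgue_on \<Omega>. \<bar>h x\<bar> \<le> B"
  shows "(\<lambda>x. h x *\<^sub>R f x) \<in> L2 \<Omega>"
proof -
  have m: "(\<lambda>x. h x *\<^sub>R f x) \<in> borel_measurable (lebesgue_on \<Omega>)"
    by (intro borel_measurable_scaleR h L2_measurable f)
  have "integrable (lebesgue_on \<Omega>) (\<lambda>x. (norm (h x *\<^sub>R f x))\<^sup>2)"
  proof (rule Bochner_Integration.integrable_bound)
    show "integrable (lebesgue_on \<Omega>) (\<lambda>x. B\<^sup>2 * (norm (f x))\<^sup>2)"
      using f by (intro integrable_mult_right L2_integrable)
    show "(\<lambda>x. (norm (h x *\<^sub>R f x))\<^sup>2) \<in> borel_measurable (lebesgue_on \<Omega>)"
      using m by measurable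
    show "AE x in lebesgue_on \<Omega>. norm ((norm (h x *\<^sub>R f x))\<^sup>2) \<le> norm (B\<^sup>2 * (norm (f x))\<^sup>2)"
      using bd
    proof eventually_elim
      case (elim x)
      then have "\<bar>h x\<bar>\<^sup>2 \<le> B\<^sup>2" by (intro power_mono) auto
      then show ?case by (simp add: power_mult_distrib mult_right_mono)
    qed
  qed
  with m show ?thesis by (simp add: L2_def)
qed

lemma L2_scale: "f \<in> L2 \<Omega> \<Longrightarrow> (\<lambda>x. (c::real) *\<^sub>R f x) \<in> L2 \<Omega>"
  by (rule L2_bounded_mult[where B = "\<bar>c\<bar>"]) auto

lemma norm_add_sq_le: "(norm (a + b))\<^sup>2 \<le> 2 * (norm (a::'a::real_inner))\<^sup>2 + 2 * (norm b)\<^sup>2"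
proof -
  have "(norm (a + b))\<^sup>2 + (norm (a - b))\<^sup>2 = 2 * (norm a)\<^sup>2 + 2 * (norm b)\<^sup>2"
    unfolding power2_norm_eq_inner by (simp add: inner_add inner_diff inner_commute)
  moreover have "0 \<le> (norm (a - b))\<^sup>2" by simp
  ultimately show ?thesis by linarith
qed

lemma L2_add:
  assumes "f \<in> L2 \<Omega>" "g \<in> L2 \<Omega>"
  shows "(\<lambda>x. f x + g x) \<in> L2 \<Omega>"
proof -
  have m: "(\<lambda>x. f x + g x) \<in> borel_measurable (lebesgue_on \<Omega>)"
    by (intro borel_measurable_add L2_measurable assms)
  have "integrable (lebesgue_on \<Omega>) (\<lambda>x. (norm (f x + g x))\<^sup>2)"
  proof (rule Bochner_Integration.integrable_bound)
    show "integrable (lebesgue_on \<Omega>) (\<lambda>x. 2 * (norm (f x))\<^sup>2 + 2 * (norm (g x))\<^sup>2)"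
      by (intro Bochner_Integration.integrable_add integrable_mult_right L2_integrable assms)
    show "(\<lambda>x. (norm (f x + g x))\<^sup>2) \<in> borel_measurable (lebesgue_on \<Omega>)"
      using m by measurable
  qed (simp add: norm_add_sq_le)
  with m show ?thesis by (simp add: L2_def)
qed

lemma L2_diff: "f \<in> L2 \<Omega> \<Longrightarrow> g \<in> L2 \<Omega> \<Longrightarrow> (\<lambda>x. f x - g x) \<in> L2 \<Omega>"
  using L2_add[OF _ L2_scale[of g \<Omega> "-1"], of f] by simp

lemma L2_real_scale:
  fixes f :: "'a::euclidean_space \<Rightarrow> real"
  shows "f \<in> L2 \<Omega> \<Longrightarrow> (\<lambda>x. c * f x) \<in> L2 \<Omega>"
  using L2_scale[of f \<Omega> c] by simp

lemma L2_inner_const: 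
  assumes "f \<in> L2 \<Omega>"
  shows "(\<lambda>x. f x \<bullet> i) \<in> L2 \<Omega>"
proof -
  have m: "(\<lambda>x. f x \<bullet> i) \<in> borel_measurable (lebesgue_on \<Omega>)"
    by (intro borel_measurable_inner L2_measurable assms borel_measurable_const)
  have "integrable (lebesgue_on \<Omega>) (\<lambda>x. (norm (f x \<bullet> i))\<^sup>2)"
  proof (rule Bochner_Integration.integrable_bound)
    show "integrable (lebesgue_on \<Omega>) (\<lambda>x. (norm i)\<^sup>2 * (norm (f x))\<^sup>2)"
      by (intro integrable_mult_right L2_integrable assms)
    show "(\<lambda>x. (norm (f x \<bullet> i))\<^sup>2) \<in> borel_measurable (lebesgue_on \<Omega>)"
      using m by measurable
    have "(norm (a \<bullet> i))\<^sup>2 \<le> (norm i)\<^sup>2 * (norm a)\<^sup>2" for a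
      using Cauchy_Schwarz_ineq2[of a i]
      by (metis abs_ge_zero mult.commute power_mono power_mult_distrib real_norm_def)
    then show "AE x in lebesgue_on \<Omega>. norm ((norm (f x \<bullet> i))\<^sup>2) \<le> norm ((norm i)\<^sup>2 * (norm (f x))\<^sup>2)"
      by simp
  qed
  with m show ?thesis by (simp add: L2_def)
qed

lemma L2_dominated:
  assumes "f \<in> L2 \<Omega>" "g \<in> borel_measurable (lebesgue_on \<Omega>)" "AE x in lebesgue_on \<Omega>. norm (g x) \<le> norm (f x)"
  shows "g \<in> L2 \<Omega>"
proof -
  have "integrable (lebesgue_on \<Omega>) (\<lambda>x. (norm (g x))\<^sup>2)"
  proof (rule Bochner_Integration.integrable_bound[OF L2_integrable[OF assms(1)]])
    show "(\<lambda>x. (norm (g x))\<^sup>2) \<in> borel_measurable (lebesgue_on \<Omega>)"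
      using assms(2) by measurable
    show "AE x in lebesgue_on \<Omega>. norm ((norm (g x))\<^sup>2) \<le> norm ((norm (f x))\<^sup>2)"
      using assms(3) by eventually_elim (simp add: power_mono)
  qed
  with assms(2) show ?thesis by (simp add: L2_def)
qed

lemma L2_norm_add_le:
  assumes "f \<in> L2 \<Omega>" "g \<in> L2 \<Omega>"
  shows "(LINT x|lebesgue_on \<Omega>. (norm (f x + g x))\<^sup>2)
    \<le> 2 * (LINT x|lebesgue_on \<Omega>. (norm (f x))\<^sup>2) + 2 * (LINT x|lebesgue_on \<Omega>. (norm (g x))\<^sup>2)"
proof -
  have "(LINT x|lebesgue_on \<Omega>. (norm (f x + g x))\<^sup>2)
      \<le> (LINT x|lebesgue_on \<Omega>. 2 * (norm (f x))\<^sup>2 + 2 * (norm (g x))\<^sup>2)"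
    using assms
    by (intro integral_mono L2_integrable L2_add Bochner_Integration.integrable_add
         integrable_mult_right norm_add_sq_le)
  also have "\<dots> = 2 * (LINT x|lebesgue_on \<Omega>. (norm (f x))\<^sup>2) + 2 * (LINT x|lebesgue_on \<Omega>. (norm (g x))\<^sup>2)"
    using assms by (simp add: L2_integrable)
  finally show ?thesis .
qed

lemma L2_Cauchy_Schwarz:
  assumes "f \<in> L2 \<Omega>" "g \<in> L2 \<Omega>"
  shows "\<bar>LINT x|lebesgue_on \<Omega>. f x \<bullet> g x\<bar>
    \<le> sqrt (LINT x|lebesgue_on \<Omega>. (norm (f x))\<^sup>2) * sqrt (LINT x|lebesgue_on \<Omega>. (norm (g x))\<^sup>2)"
proof -
  define a b m where "a = (LINT x|lebesgue_on \<Omega>. (norm (f x))\<^sup>2)"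
    and "b = (LINT x|lebesgue_on \<Omega>. (norm (g x))\<^sup>2)" and "m = (LINT x|lebesgue_on \<Omega>. f x \<bullet> g x)"
  have pos: "0 \<le> s\<^sup>2 * a + 2 * s * t * m + t\<^sup>2 * b" for s t
  proof -
    have "(norm (s *\<^sub>R f x + t *\<^sub>R g x))\<^sup>2 = s\<^sup>2 * (norm (f x))\<^sup>2 + 2 * s * t * (f x \<bullet> g x) + t\<^sup>2 * (norm (g x))\<^sup>2" for x
      unfolding power2_norm_eq_inner
      by (simp add: inner_add_left inner_add_right inner_commute[of "g x" "f x"] algebra_simps power2_eq_square
          del: dot_square_norm)
    then have "(LINT x|lebesgue_on \<Omega>. (norm (s *\<^sub>R f x + t *\<^sub>R g x))\<^sup>2) = s\<^sup>2 * a + 2 * s * t * m + t\<^sup>2 * b"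
      using assms by (simp add: a_def b_def m_def L2_integrable L2_inner_integrable)
    moreover have "0 \<le> (LINT x|lebesgue_on \<Omega>. (norm (s *\<^sub>R f x + t *\<^sub>R g x))\<^sup>2)"
      by (rule integral_nonneg_AE) simp
    ultimately show ?thesis by (simp only:)
  qed
  have ab: "0 \<le> a" "0 \<le> b"
    unfolding a_def b_def by (rule integral_nonneg_AE, simp)+
  have "m\<^sup>2 \<le> a * b"
  proof (cases "a = 0")
    case True
    have "m = 0"
    proof (rule ccontr)
      assume "m \<noteq> 0"
      then have "2 * (- (b + 1) / (2 * m)) * 1 * m = - (b + 1)" by simp
      then show False using pos[of "- (b + 1) / (2 * m)" 1] True by simp
    qed
    with ab show ?thesis by simp
  next
    case False
    have "0 \<le> a * (a * b - m\<^sup>2)" 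
    proof -
      have "m * m * a + 2 * - m * a * m + a * a * b = a * (a * b - m * m)" by algebra
      then show ?thesis using pos[of "- m" a] by (simp add: power2_eq_square)
    qed
    then show ?thesis using False ab by (simp add: zero_le_mult_iff)
  qed
  then show ?thesis
    using real_sqrt_le_mono[of "m\<^sup>2" "a * b"] by (simp add: real_sqrt_mult a_def b_def m_def)
qed

lemma open_sets_lebesgue [simp]: "open \<Omega> \<Longrightarrow> \<Omega> \<in> sets lebesgue"
  by (rule sets_completionI_sets) simp

lemma integral_lebesgue_on_indicator:
  fixes f :: "'a::euclidean_space \<Rightarrow> 'b::{banach, second_countable_topology}"
  shows "\<Omega> \<in> sets lebesgue \<Longrightarrow> (LINT x|lebesgue_on \<Omega>. f x) = (LINT x|lebesgue. indicator \<Omega> x *\<^sub>R f x)"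
  by (simp add: integral_restrict_space)

lemma L2_UNIV_I:
  fixes f :: "'a::euclidean_space \<Rightarrow> 'b::euclidean_space"
  assumes "f \<in> borel_measurable lebesgue" "integrable lebesgue (\<lambda>x. (norm (f x))\<^sup>2)"
  shows "f \<in> L2 UNIV"
  using assms by (simp add: L2_def lebesgue_on_UNIV_eq)

lemma L2_UNIV_measurable: "f \<in> L2 UNIV \<Longrightarrow> f \<in> borel_measurable lebesgue"
  and L2_UNIV_integrable: "f \<in> L2 UNIV \<Longrightarrow> integrable lebesgue (\<lambda>x. (norm (f x))\<^sup>2)"
  by (simp_all add: L2_def lebesgue_on_UNIV_eq)

lemma L2_extend_zero:
  fixes f :: "'a::euclidean_space \<Rightarrow> 'b::euclidean_space"
  assumes "\<Omega> \<in> sets lebesgue"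
  shows "(\<lambda>x. indicator \<Omega> x *\<^sub>R f x) \<in> L2 UNIV \<longleftrightarrow> f \<in> L2 \<Omega>"
proof -
  have "(\<lambda>x. (norm (indicator \<Omega> x *\<^sub>R f x))\<^sup>2) = (\<lambda>x. indicator \<Omega> x *\<^sub>R (norm (f x))\<^sup>2)"
    by (auto simp: indicator_def fun_eq_iff)
  with assms show ?thesis
    by (simp add: L2_def lebesgue_on_UNIV_eq borel_measurable_restrict_space_iff integrable_restrict_space
          del: norm_scaleR)
qed

lemma L2_restrict:
  assumes "\<Omega> \<in> sets lebesgue" "f \<in> L2 UNIV"
  shows "f \<in> L2 \<Omega>"
proof -
  have "(\<lambda>x. indicator \<Omega> x *\<^sub>R f x) \<in> L2 UNIV"
    using assms by (intro L2_bounded_mult[where B = 1]) (auto simp: lebesgue_on_UNIV_eq)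
  then show ?thesis using L2_extend_zero[OF assms(1), of f] by simp
qed

lemma continuous_lebesgue_measurable:
  fixes f :: "'a::euclidean_space \<Rightarrow> 'b::euclidean_space"
  shows "continuous_on UNIV f \<Longrightarrow> f \<in> borel_measurable lebesgue"
  by (rule measurable_completion) (simp add: borel_measurable_continuous_onI)

lemma test_function_measurable: "\<phi> \<in> test_functions \<Omega> \<Longrightarrow> \<phi> \<in> borel_measurable lebesgue"
  by (intro continuous_lebesgue_measurable test_function_continuous)

lemma compact_indicator_integrable:
  "compact (K::'a::euclidean_space set) \<Longrightarrow> integrable lebesgue (indicator K :: 'a \<Rightarrow> real)"
  using lmeasurable_compact[of K] by (auto intro!: integrable_real_indicator simp: fmeasurable_def)

lemma test_function_L2_UNIV: 
  assumes "\<phi> \<in> test_functions \<Omega>"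
  shows "\<phi> \<in> L2 UNIV"
proof -
  obtain K where K: "compact K" "K \<subseteq> \<Omega>" "\<And>x. x \<notin> K \<Longrightarrow> \<phi> x = 0"
    using assms by (meson test_functionsE)
  obtain B where B: "0 < B" "\<And>x. \<bar>\<phi> x\<bar> \<le> B"
    using assms by (meson test_function_bounded)
  have "integrable lebesgue (\<lambda>x. (norm (\<phi> x))\<^sup>2)"
  proof (rule Bochner_Integration.integrable_bound)
    show "integrable lebesgue (\<lambda>x. B\<^sup>2 * indicator K x)"
      using K by (intro integrable_mult_right compact_indicator_integrable)
    show "(\<lambda>x. (norm (\<phi> x))\<^sup>2) \<in> borel_measurable lebesgue"
      using test_function_measurable[OF assms] by measurable
    have "norm ((norm (\<phi> x))\<^sup>2) \<le> norm (B\<^sup>2 * indicator K x)" for x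
      using K(3)[of x] power_mono[OF B(2)[of x], of 2] by (cases "x \<in> K") auto
    then show "AE x in lebesgue. norm ((norm (\<phi> x))\<^sup>2) \<le> norm (B\<^sup>2 * indicator K x)" by simp
  qed
  then show ?thesis by (intro L2_UNIV_I test_function_measurable[OF assms])
qed

lemma test_function_L2: "\<phi> \<in> test_functions \<Omega>' \<Longrightarrow> \<Omega> \<in> sets lebesgue \<Longrightarrow> \<phi> \<in> L2 \<Omega>"
  by (rule L2_restrict[OF _ test_function_L2_UNIV])

section \<open>Density of the test functions\<close>

text \<open>Membership in the \<open>L\<^sup>2\<close> closure, over the whole space, of the test functions on \<open>V\<close>.\<close>

definition approximable :: "'a::euclidean_space set \<Rightarrow> ('a \<Rightarrow> real) \<Rightarrow> bool" where
  "approximable V f \<longleftrightarrow> f \<in> L2 UNIV \<and>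
     (\<forall>\<epsilon>>0. \<exists>\<psi>\<in>test_functions V. (LINT x|lebesgue. (norm (f x - \<psi> x))\<^sup>2) < \<epsilon>)"

lemma approximable_limit:
  assumes f: "f \<in> L2 UNIV"
    and lim: "\<And>\<epsilon>. 0 < \<epsilon> \<Longrightarrow> \<exists>g. approximable V g \<and> (LINT x|lebesgue. (norm (f x - g x))\<^sup>2) < \<epsilon>"
  shows "approximable V f"
  unfolding approximable_def
proof (intro conjI allI impI f)
  fix \<epsilon> :: real assume "\<epsilon> > 0"
  then have "\<epsilon> / 4 > 0" by simp
  from lim[OF this] obtain g where g: "approximable V g" "(LINT x|lebesgue. (norm (f x - g x))\<^sup>2) < \<epsilon> / 4"
    by blast
  then obtain \<psi> where \<psi>: "\<psi> \<in> test_functions V" "(LINT x|lebesgue. (norm (g x - \<psi> x))\<^sup>2) < \<epsilon> / 4"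
    using \<open>\<epsilon> / 4 > 0\<close> unfolding approximable_def by blast
  have "(LINT x|lebesgue. (norm (f x - \<psi> x))\<^sup>2) < \<epsilon>"
    using L2_norm_add_le[of "\<lambda>x. f x - g x" UNIV "\<lambda>x. g x - \<psi> x"] g f \<psi>
      test_function_L2_UNIV[OF \<psi>(1)]
    by (simp add: lebesgue_on_UNIV_eq L2_diff approximable_def)
  with \<psi>(1) show "\<exists>\<psi>\<in>test_functions V. (LINT x|lebesgue. (norm (f x - \<psi> x))\<^sup>2) < \<epsilon>" by blast
qed

lemma approximable_zero: "approximable V (\<lambda>x. 0)"
  unfolding approximable_def
  by (auto intro!: L2_UNIV_I bexI[OF _ test_function_zero])

lemma approximable_add:
  assumes "approximable V f" "approximable V g"
  shows "approximable V (\<lambda>x. f x + g x)"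
  unfolding approximable_def
proof (intro conjI allI impI)
  show "(\<lambda>x. f x + g x) \<in> L2 UNIV" using assms by (simp add: approximable_def L2_add)
  fix \<epsilon> :: real assume "\<epsilon> > 0"
  then have e: "\<epsilon> / 4 > 0" by simp
  obtain \<psi> where \<psi>: "\<psi> \<in> test_functions V" "(LINT x|lebesgue. (norm (f x - \<psi> x))\<^sup>2) < \<epsilon> / 4"
    using assms(1) e unfolding approximable_def by blast
  obtain \<psi>' where \<psi>': "\<psi>' \<in> test_functions V" "(LINT x|lebesgue. (norm (g x - \<psi>' x))\<^sup>2) < \<epsilon> / 4"
    using assms(2) e unfolding approximable_def by blast
  have "(LINT x|lebesgue. (norm ((f x - \<psi> x) + (g x - \<psi>' x)))\<^sup>2) < \<epsilon>"
    using L2_norm_add_le[of "\<lambda>x. f x - \<psi> x" UNIV "\<lambda>x. g x - \<psi>' x"] assms \<psi> \<psi>'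
      test_function_L2_UNIV[OF \<psi>(1)] test_function_L2_UNIV[OF \<psi>'(1)]
    by (simp add: lebesgue_on_UNIV_eq L2_diff approximable_def)
  moreover have "(f x - \<psi> x) + (g x - \<psi>' x) = f x + g x - (\<psi> x + \<psi>' x)" for x by simp
  ultimately show "\<exists>\<psi>\<in>test_functions V. (LINT x|lebesgue. (norm (f x + g x - \<psi> x))\<^sup>2) < \<epsilon>"
    using test_function_add[OF \<psi>(1) \<psi>'(1)] by (intro bexI[of _ "\<lambda>x. \<psi> x + \<psi>' x"]) simp_all
qed

lemma approximable_scale:
  assumes "approximable V f"
  shows "approximable V (\<lambda>x. c * f x)"
  unfolding approximable_def
proof (intro conjI allI impI)
  show "(\<lambda>x. c * f x) \<in> L2 UNIV" using assms by (simp add: approximable_def L2_real_scale)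
  fix \<epsilon> :: real assume "\<epsilon> > 0"
  define e where "e = \<epsilon> / (c\<^sup>2 + 1)"
  have c1: "c\<^sup>2 + 1 > 0" by (simp add: add_nonneg_pos)
  have e: "e > 0" using \<open>\<epsilon> > 0\<close> c1 by (simp add: e_def)
  obtain \<psi> where \<psi>: "\<psi> \<in> test_functions V" "(LINT x|lebesgue. (norm (f x - \<psi> x))\<^sup>2) < e"
    using assms e unfolding approximable_def by blast
  have "(norm (c * f x - c * \<psi> x))\<^sup>2 = c\<^sup>2 * (norm (f x - \<psi> x))\<^sup>2" for x
    by (simp add: right_diff_distrib[symmetric] power_mult_distrib)
  then have "(LINT x|lebesgue. (norm (c * f x - c * \<psi> x))\<^sup>2) = c\<^sup>2 * (LINT x|lebesgue. (norm (f x - \<psi> x))\<^sup>2)"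
    by simp
  also have "\<dots> \<le> c\<^sup>2 * e" using \<psi>(2) by (intro mult_left_mono) auto
  also have "\<dots> < \<epsilon>" using c1 \<open>\<epsilon> > 0\<close> by (simp add: e_def field_simps)
  finally show "\<exists>\<psi>\<in>test_functions V. (LINT x|lebesgue. (norm (c * f x - \<psi> x))\<^sup>2) < \<epsilon>"
    by (intro bexI[OF _ test_function_scale[OF \<psi>(1)]])
qed

lemma approximable_sum:
  "(\<And>j. j \<in> J \<Longrightarrow> approximable V (f j)) \<Longrightarrow> approximable V (\<lambda>x. \<Sum>j\<in>J. f j x)"
  by (induction J rule: infinite_finite_induct) (auto intro: approximable_zero approximable_add)

text \<open>
  A bounded measurable set lies between a compact \<open>K\<close> and an open \<open>T\<close> of almost the same
  measure. If \<open>s\<close> is a nonnegative test function on \<open>V \<inter> T\<close>, positive on \<open>K\<close>, then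
  \<open>1 - exp(-n s)\<close> tends to one on \<open>K\<close>, which replaces an exact smooth cutoff.
\<close>

lemma approximable_indicator:
  fixes V :: "'a::euclidean_space set"
  assumes "open V" "A \<in> sets lebesgue" "bounded A" "A \<subseteq> V"
  shows "approximable V (indicator A)"
proof -
  have A: "A \<in> lmeasurable" using assms by (simp add: bounded_set_imp_lmeasurable)
  then have intA: "integrable lebesgue (indicator A :: 'a \<Rightarrow> real)"
    by (auto intro!: integrable_real_indicator simp: fmeasurable_def)
  show ?thesis unfolding approximable_def
  proof (intro conjI allI impI)
    show "(indicator A :: 'a \<Rightarrow> real) \<in> L2 UNIV"
    proof (intro L2_UNIV_I)
      have "(\<lambda>x. (norm (indicator A x :: real))\<^sup>2) = indicator A"
        by (auto simp: indicator_def)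
      with intA show "integrable lebesgue (\<lambda>x. (norm (indicator A x :: real))\<^sup>2)" by metis
      show "(indicator A :: 'a \<Rightarrow> real) \<in> borel_measurable lebesgue" using assms(2) by simp
    qed
    fix \<epsilon> :: real assume "\<epsilon> > 0"
    then have e: "\<epsilon> / 4 > 0" by simp
    obtain T where T: "open T" "A \<subseteq> T" "T - A \<in> lmeasurable" "emeasure lebesgue (T - A) < ennreal (\<epsilon> / 4)"
      using sets_lebesgue_outer_open[OF assms(2) e] by metis
    obtain K where K: "closed K" "K \<subseteq> A" "A - K \<in> lmeasurable" "emeasure lebesgue (A - K) < ennreal (\<epsilon> / 4)"
      using sets_lebesgue_inner_closed[OF assms(2) e] by metis
    have cK: "compact K" using K(1,2) assms(3) bounded_subset compact_eq_bounded_closed by blast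
    define D where "D = (T - A) \<union> (A - K)"
    have D: "D \<in> lmeasurable" using T K by (simp add: D_def fmeasurable.Un)
    have mT: "measure lebesgue (T - A) < \<epsilon> / 4" "measure lebesgue (A - K) < \<epsilon> / 4"
      using T(3,4) K(3,4) e by (simp_all add: emeasure_eq_measure2 ennreal_less_iff)
    then have mD: "measure lebesgue D < \<epsilon> / 2"
      using measure_Un_le[of "T - A" lebesgue "A - K"] T(3) K(3) by (simp add: D_def fmeasurableD)
    obtain s where s: "s \<in> test_functions (V \<inter> T)" "\<And>x. 0 \<le> s x" "\<And>x. x \<in> K \<Longrightarrow> 0 < s x"
      using positive_test_function[OF cK, of "V \<inter> T"] assms(1,4) T(1,2) K(2) by blast
    define \<psi> where "\<psi> n x = 1 - exp (- (real n * s x))" for n x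
    have \<psi>_test: "\<psi> n \<in> test_functions (V \<inter> T)" for n
    proof -
      obtain L where L: "compact L" "L \<subseteq> V \<inter> T" "\<And>x. x \<notin> L \<Longrightarrow> s x = 0"
        using s(1) by (meson test_functionsE)
      have "C_k k (\<psi> n)" for k
        using C_k_diff[OF C_k_const[of k 1] C_k_exp[OF C_k_mult[OF C_k_const[of k "- real n"]
            test_functions_C_k[OF s(1)]]]]
        by (simp add: \<psi>_def[abs_def])
      then show ?thesis by (rule test_functionsI[OF _ L(1,2)]) (simp add: \<psi>_def L(3))
    qed
    have \<psi>01: "0 \<le> \<psi> n x" "\<psi> n x \<le> 1" for n x
      using s(2) by (auto simp: \<psi>_def)
    define r where "r n x = indicator K x * (norm (1 - \<psi> n x))\<^sup>2" for n x
    have "(\<lambda>n. LINT x|lebesgue. r n x) \<longlonglongrightarrow> (LINT x|(lebesgue :: 'a measure). (0::real))"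
    proof (rule integral_dominated_convergence)
      show "integrable lebesgue (indicator K :: 'a \<Rightarrow> real)" by (rule compact_indicator_integrable[OF cK])
      have "K \<in> sets lebesgue" by (rule fmeasurableD[OF lmeasurable_compact[OF cK]])
      then show "r n \<in> borel_measurable lebesgue" for n
        unfolding r_def using test_function_measurable[OF \<psi>_test[of n]] by measurable
      have "(\<lambda>n. r n x) \<longlonglongrightarrow> 0" for x
      proof (cases "x \<in> K")
        case True
        have "(\<lambda>n. exp (- s x) ^ n) \<longlonglongrightarrow> 0"
          using s(3)[OF True] by (intro LIMSEQ_power_zero) simp
        then have "(\<lambda>n. (exp (- s x) ^ n)\<^sup>2) \<longlonglongrightarrow> 0\<^sup>2" by (intro tendsto_power)
        then show ?thesis using True by (simp add: r_def \<psi>_def exp_of_nat_mult[symmetric])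
      qed (simp add: r_def)
      then show "AE x in lebesgue. (\<lambda>n. r n x) \<longlonglongrightarrow> 0" by simp
      have "norm (r n x) \<le> indicator K x" for n x
        using \<psi>01[of n x] by (auto simp: r_def indicator_def power_le_one)
      then show "AE x in lebesgue. norm (r n x) \<le> indicator K x" for n by simp
    qed simp
    then have "\<forall>\<^sub>F n in sequentially. (LINT x|lebesgue. r n x) < \<epsilon> / 2"
      using \<open>\<epsilon> > 0\<close> by (intro order_tendstoD(2)[of _ 0]) auto
    then obtain n where n: "(LINT x|lebesgue. r n x) < \<epsilon> / 2"
      by (auto simp: eventually_sequentially)
    have int_r: "integrable lebesgue (r n)"
    proof (rule Bochner_Integration.integrable_bound[OF compact_indicator_integrable[OF cK]])
      have "K \<in> sets lebesgue" by (rule fmeasurableD[OF lmeasurable_compact[OF cK]])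
      then show "r n \<in> borel_measurable lebesgue"
        unfolding r_def using test_function_measurable[OF \<psi>_test[of n]] by measurable
      show "AE x in lebesgue. norm (r n x) \<le> norm (indicator K x :: real)"
        using \<psi>01[of n] by (auto simp: r_def indicator_def power_le_one)
    qed
    have int_D: "integrable lebesgue (indicator D :: 'a \<Rightarrow> real)"
      using D by (auto intro!: integrable_real_indicator simp: fmeasurable_def)
    have ptw: "(norm (indicator A x - \<psi> n x))\<^sup>2 \<le> r n x + indicator D x" for x
    proof -
      consider "x \<in> K" | "x \<in> D" "x \<notin> K" | "x \<notin> T" "x \<notin> K" "x \<notin> A" "x \<notin> D"
        using T(2) K(2) by (auto simp: D_def)
      then show ?thesis
      proof cases
        case 1 with K(2) show ?thesis by (auto simp: r_def indicator_def)
      next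
        case 2
        have "norm (indicator A x - \<psi> n x) \<le> 1"
          using \<psi>01[of n x] by (auto simp: indicator_def)
        then show ?thesis using 2 power_le_one[of "norm (indicator A x - \<psi> n x)" 2] by (auto simp: r_def)
      next
        case 3
        then have "\<psi> n x = 0" using test_function_outside[OF \<psi>_test] by blast
        then show ?thesis using 3 by (simp add: r_def)
      qed
    qed
    have "(LINT x|lebesgue. (norm (indicator A x - \<psi> n x))\<^sup>2) \<le> (LINT x|lebesgue. r n x + indicator D x)"
    proof (rule integral_mono')
      show "integrable lebesgue (\<lambda>x. r n x + indicator D x)" using int_r int_D by simp
      show "0 \<le> r n x + indicator D x" for x by (simp add: r_def)
    qed (rule ptw)
    also have "\<dots> = (LINT x|lebesgue. r n x) + measure lebesgue D"
      using int_r int_D by simp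
    also have "\<dots> < \<epsilon>" using n mD by simp
    finally show "\<exists>\<psi>\<in>test_functions V. (LINT x|lebesgue. (norm (indicator A x - \<psi> x))\<^sup>2) < \<epsilon>"
      using \<psi>_test[of n] test_functions_mono[of "V \<inter> T" V] by blast
  qed
qed

text \<open>Approximation by simple functions with bounded support.\<close>

lemma test_functions_dense:
  fixes V :: "'a::euclidean_space set"
  assumes V: "open V" and f: "f \<in> L2 UNIV" and zero: "\<And>x. x \<notin> V \<Longrightarrow> f x = 0"
  shows "approximable V f"
proof (rule approximable_limit[OF f])
  fix \<epsilon> :: real assume e: "\<epsilon> > 0"
  obtain F where F: "\<And>n. simple_function lebesgue (F n)" "\<And>x. (\<lambda>n. F n x) \<longlonglongrightarrow> f x"
    "\<And>n x. norm (F n x) \<le> 2 * norm (f x)"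
    using borel_measurable_implies_sequence_metric[OF L2_UNIV_measurable[OF f], of 0] by auto
  define G where "G n x = indicator (ball 0 (real n)) x * F n x" for n x
  have sG: "simple_function lebesgue (G n)" for n
    unfolding G_def by (intro simple_function_mult simple_function_indicator F) auto
  have bG: "\<bar>G n x\<bar> \<le> 2 * \<bar>f x\<bar>" for n x
    using F(3)[of n x] by (auto simp: G_def indicator_def)
  have tG: "(\<lambda>n. G n x) \<longlonglongrightarrow> f x" for x
  proof -
    obtain N where "norm x < real N" using reals_Archimedean2 by blast
    then have "\<forall>\<^sub>F n in sequentially. F n x = G n x"
      unfolding eventually_sequentially by (intro exI[of _ N]) (auto simp: G_def)
    with F(2) show ?thesis by (rule Lim_transform_eventually)
  qed
  have mG: "G n \<in> borel_measurable lebesgue" for n by (rule borel_measurable_simple_function[OF sG])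
  have "(\<lambda>n. LINT x|lebesgue. (norm (f x - G n x))\<^sup>2) \<longlonglongrightarrow> (LINT x|(lebesgue :: 'a measure). (0::real))"
  proof (rule integral_dominated_convergence[where w = "\<lambda>x. 9 * (norm (f x))\<^sup>2"])
    show "integrable lebesgue (\<lambda>x. 9 * (norm (f x))\<^sup>2)"
      using L2_UNIV_integrable[OF f] by simp
    show "(\<lambda>x. (norm (f x - G n x))\<^sup>2) \<in> borel_measurable lebesgue" for n
      using mG[of n] L2_UNIV_measurable[OF f] by measurable
    have "(\<lambda>n. (norm (f x - G n x))\<^sup>2) \<longlonglongrightarrow> (norm (f x - f x))\<^sup>2" for x
      by (intro tendsto_intros tG)
    then show "AE x in lebesgue. (\<lambda>n. (norm (f x - G n x))\<^sup>2) \<longlonglongrightarrow> 0" by simp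
    have "norm ((norm (f x - G n x))\<^sup>2) \<le> 9 * (norm (f x))\<^sup>2" for n x
    proof -
      have "norm (f x - G n x) \<le> 3 * norm (f x)" using bG[of n x] by simp
      then have "(norm (f x - G n x))\<^sup>2 \<le> (3 * norm (f x))\<^sup>2" by (intro power_mono) auto
      then show ?thesis by (simp add: power_mult_distrib)
    qed
    then show "AE x in lebesgue. norm ((norm (f x - G n x))\<^sup>2) \<le> 9 * (norm (f x))\<^sup>2" for n by simp
  qed simp
  then have "\<forall>\<^sub>F n in sequentially. (LINT x|lebesgue. (norm (f x - G n x))\<^sup>2) < \<epsilon>"
    using e by (intro order_tendstoD(2)[of _ 0]) auto
  then obtain n where n: "(LINT x|lebesgue. (norm (f x - G n x))\<^sup>2) < \<epsilon>"
    by (auto simp: eventually_sequentially)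
  have "approximable V (\<lambda>x. \<Sum>y\<in>G n ` UNIV. y * indicator (G n -` {y}) x)"
  proof (rule approximable_sum)
    fix y
    show "approximable V (\<lambda>x. y * indicator (G n -` {y}) x)"
    proof (cases "y = 0")
      case False
      have "x \<in> V" if "G n x = y" for x using zero[of x] bG[of n x] False that by (cases "x \<in> V") auto
      then have "G n -` {y} \<subseteq> V" by auto
      moreover have "G n -` {y} \<subseteq> ball 0 (real n)"
        using False by (auto simp: G_def indicator_def split: if_splits)
      then have "bounded (G n -` {y})" using bounded_ball bounded_subset by blast
      moreover have "G n -` {y} \<in> sets lebesgue"
        using simple_functionD(2)[OF sG, of n "{y}"] by simp
      ultimately show ?thesis using V by (intro approximable_scale approximable_indicator)
    qed (simp add: approximable_zero)
  qed
  moreover have "(\<lambda>x. \<Sum>y\<in>G n ` UNIV. y * indicator (G n -` {y}) x) = G n"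
  proof
    fix x
    have "G n x = (\<Sum>y\<in>G n ` space lebesgue. indicator (G n -` {y} \<inter> space lebesgue) x *\<^sub>R y)"
      by (rule simple_function_indicator_representation_banach[OF sG]) simp
    also have "\<dots> = (\<Sum>y\<in>G n ` UNIV. y * indicator (G n -` {y}) x)"
      by (simp add: mult.commute)
    finally show "(\<Sum>y\<in>G n ` UNIV. y * indicator (G n -` {y}) x) = G n x" by (rule sym)
  qed
  ultimately have "approximable V (G n)" by (simp only:)
  with n show "\<exists>g. approximable V g \<and> (LINT x|lebesgue. (norm (f x - g x))\<^sup>2) < \<epsilon>" by blast
qed

section \<open>Translations and integration by parts\<close>

lemma lebesgue_translate_measurable: "(\<lambda>x. x - a) \<in> lebesgue \<rightarrow>\<^sub>M (lebesgue :: 'a::euclidean_space measure)"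
  and lebesgue_translate_distr: "distr lebesgue lebesgue (\<lambda>x. x - a) = (lebesgue :: 'a measure)"
proof -
  have T: "(\<lambda>x. - a + (\<Sum>j\<in>Basis. (1 * (x \<bullet> j)) *\<^sub>R j)) = (\<lambda>x. x - a)"
    by (simp add: euclidean_representation)
  show "(\<lambda>x. x - a) \<in> lebesgue \<rightarrow>\<^sub>M (lebesgue :: 'a measure)"
    using lebesgue_affine_measurable[of "\<lambda>_. 1" "- a"] unfolding T by simp
  show "distr lebesgue lebesgue (\<lambda>x. x - a) = (lebesgue :: 'a measure)"
    using lebesgue_affine_euclidean[of "\<lambda>_. 1" "- a"] unfolding T by (simp add: density_1)
qed

lemma borel_measurable_translate:
  "f \<in> borel_measurable lebesgue \<Longrightarrow> (\<lambda>x. f (x - a)) \<in> borel_measurable lebesgue"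
  by (rule measurable_compose[OF lebesgue_translate_measurable])

lemma integral_translate:
  fixes f :: "'a::euclidean_space \<Rightarrow> real"
  assumes "f \<in> borel_measurable lebesgue"
  shows "(LINT x|lebesgue. f (x - a)) = (LINT x|lebesgue. f x)"
  using integral_distr[OF lebesgue_translate_measurable assms, of a]
  by (simp add: lebesgue_translate_distr)

lemma integrable_translate:
  fixes f :: "'a::euclidean_space \<Rightarrow> real"
  assumes "f \<in> borel_measurable lebesgue"
  shows "integrable lebesgue (\<lambda>x. f (x - a)) \<longleftrightarrow> integrable lebesgue f"
  using integrable_distr_eq[OF lebesgue_translate_measurable assms, of a]
  by (simp add: lebesgue_translate_distr)

lemma L2_translate:
  fixes f :: "'a::euclidean_space \<Rightarrow> real"
  assumes "f \<in> L2 UNIV"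
  shows "(\<lambda>x. f (x - a)) \<in> L2 UNIV"
    and "(LINT x|lebesgue. (norm (f (x - a)))\<^sup>2) = (LINT x|lebesgue. (norm (f x))\<^sup>2)"
proof -
  have m: "(\<lambda>x. (norm (f x))\<^sup>2) \<in> borel_measurable lebesgue"
    using L2_UNIV_measurable[OF assms] by measurable
  show "(\<lambda>x. f (x - a)) \<in> L2 UNIV"
    using integrable_translate[OF m] L2_UNIV_integrable[OF assms]
    by (intro L2_UNIV_I[OF borel_measurable_translate[OF L2_UNIV_measurable[OF assms]]]) simp
  show "(LINT x|lebesgue. (norm (f (x - a)))\<^sup>2) = (LINT x|lebesgue. (norm (f x))\<^sup>2)"
    using integral_translate[OF m] by simp
qed

text \<open>Local integrability on the whole space.\<close>

definition locally_integrable :: "('a::euclidean_space \<Rightarrow> real) \<Rightarrow> bool" where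
  "locally_integrable w \<longleftrightarrow> w \<in> borel_measurable lebesgue \<and>
     (\<forall>K. compact K \<longrightarrow> integrable lebesgue (\<lambda>x. indicator K x * w x))"

lemma locally_integrable_L2:
  assumes "w \<in> L2 UNIV"
  shows "locally_integrable w"
  unfolding locally_integrable_def
proof (intro conjI allI impI)
  show "w \<in> borel_measurable lebesgue" by (rule L2_UNIV_measurable[OF assms])
  fix K :: "'a set" assume K: "compact K"
  have "(\<lambda>x. (norm (indicator K x :: real))\<^sup>2) = indicator K" by (auto simp: indicator_def)
  then have "(indicator K :: 'a \<Rightarrow> real) \<in> L2 UNIV"
    using K fmeasurableD[OF lmeasurable_compact[OF K]]
    by (intro L2_UNIV_I) (simp_all only: compact_indicator_integrable borel_measurable_indicator)
  from L2_mult_integrable[OF this assms] show "integrable lebesgue (\<lambda>x. indicator K x * w x)"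
    by (simp add: lebesgue_on_UNIV_eq)
qed

lemma locally_integrable_const: "locally_integrable (\<lambda>x. c)"
  by (auto simp: locally_integrable_def compact_indicator_integrable)

lemma locally_integrable_bound:
  assumes "locally_integrable v" "w \<in> borel_measurable lebesgue" "\<And>x. \<bar>w x\<bar> \<le> \<bar>v x\<bar>"
  shows "locally_integrable w"
  unfolding locally_integrable_def
proof (intro conjI allI impI)
  fix K :: "'a set" assume K: "compact K"
  have [measurable]: "K \<in> sets lebesgue" by (rule fmeasurableD[OF lmeasurable_compact[OF K]])
  have [measurable]: "w \<in> borel_measurable lebesgue" by fact
  show "integrable lebesgue (\<lambda>x. indicator K x * w x)"
  proof (rule Bochner_Integration.integrable_bound)
    show "integrable lebesgue (\<lambda>x. indicator K x * v x)"
      using assms(1) K by (simp add: locally_integrable_def)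
    show "(\<lambda>x. indicator K x * w x) \<in> borel_measurable lebesgue" by measurable
    show "AE x in lebesgue. norm (indicator K x * w x) \<le> norm (indicator K x * v x)"
      using assms(3) by (simp add: abs_mult mult_left_mono)
  qed
qed fact

lemma locally_integrable_add:
  "locally_integrable v \<Longrightarrow> locally_integrable w \<Longrightarrow> locally_integrable (\<lambda>x. v x + w x)"
  by (auto simp: locally_integrable_def distrib_left)

lemma locally_integrable_times_test:
  assumes w: "locally_integrable w" and \<phi>: "\<phi> \<in> test_functions \<Omega>"
  shows "integrable lebesgue (\<lambda>x. w x * \<phi> x)"
proof -
  obtain K where K: "compact K" "K \<subseteq> \<Omega>" "\<And>x. x \<notin> K \<Longrightarrow> \<phi> x = 0"
    using \<phi> by (meson test_functionsE)
  obtain B where B: "0 < B" "\<And>x. \<bar>\<phi> x\<bar> \<le> B"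
    using \<phi> by (meson test_function_bounded)
  show ?thesis
  proof (rule Bochner_Integration.integrable_bound)
    show "integrable lebesgue (\<lambda>x. B * (indicator K x * w x))"
      using w K(1) by (intro integrable_mult_right) (simp add: locally_integrable_def)
    show "(\<lambda>x. w x * \<phi> x) \<in> borel_measurable lebesgue"
      using w test_function_measurable[OF \<phi>]
      by (intro borel_measurable_times) (simp_all add: locally_integrable_def)
    have "\<bar>w x * \<phi> x\<bar> \<le> \<bar>B * (indicator K x * w x)\<bar>" for x
    proof (cases "x \<in> K")
      case True
      have "\<bar>w x * \<phi> x\<bar> \<le> \<bar>w x\<bar> * B"
        unfolding abs_mult by (rule mult_left_mono[OF B(2) abs_ge_zero])
      with True B(1) show ?thesis by (simp add: abs_mult mult.commute[of "\<bar>w x\<bar>" B])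
    qed (simp add: K(3))
    then show "AE x in lebesgue. norm (w x * \<phi> x) \<le> norm (B * (indicator K x * w x))" by simp
  qed
qed

lemma test_function_line_derivative:
  assumes "\<phi> \<in> test_functions \<Omega>"
  shows "((\<lambda>s. \<phi> (x - s *\<^sub>R i)) has_real_derivative - frechet_derivative \<phi> (at (x - s *\<^sub>R i)) i) (at s)"
proof -
  have lin: "linear (frechet_derivative \<phi> (at (x - s *\<^sub>R i)))"
    by (rule has_derivative_linear[OF test_function_has_derivative[OF assms]])
  have "((\<lambda>s. x - s *\<^sub>R i) has_derivative (\<lambda>t. - (t *\<^sub>R i))) (at s)"
    using has_derivative_diff[OF has_derivative_const
        bounded_linear_imp_has_derivative[OF bounded_linear_scaleR_left]] by simp
  from has_derivative_compose[OF this test_function_has_derivative[OF assms]]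
  have "((\<lambda>s. \<phi> (x - s *\<^sub>R i)) has_derivative (\<lambda>t. frechet_derivative \<phi> (at (x - s *\<^sub>R i)) (- (t *\<^sub>R i)))) (at s)" .
  moreover have "(\<lambda>t. frechet_derivative \<phi> (at (x - s *\<^sub>R i)) (- (t *\<^sub>R i)))
      = (*) (- frechet_derivative \<phi> (at (x - s *\<^sub>R i)) i)"
    by (simp add: fun_eq_iff linear_neg[OF lin] linear_scale[OF lin] mult.commute)
  ultimately show ?thesis by (simp only: has_field_derivative_def)
qed

text \<open>Differentiation under the integral sign: the difference quotients of \<open>\<phi>\<close> along \<open>i\<close> are
  bounded and, for bounded increments, supported in a fixed ball.\<close>

lemma translation_derivative:
  assumes w: "locally_integrable w" and \<phi>: "\<phi> \<in> test_functions \<Omega>" and i: "i \<in> Basis"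
  shows "((\<lambda>s. LINT x|lebesgue. w x * \<phi> (x - s *\<^sub>R i)) has_real_derivative
      - (LINT x|lebesgue. w x * frechet_derivative \<phi> (at x) i)) (at 0)"
proof -
  obtain K where K: "compact K" "K \<subseteq> \<Omega>" "\<And>x. x \<notin> K \<Longrightarrow> \<phi> x = 0"
    using \<phi> by (meson test_functionsE)
  obtain B where B: "0 < B" "\<And>x. \<bar>frechet_derivative \<phi> (at x) i\<bar> \<le> B"
    using test_function_partial[OF \<phi> i] by (meson test_function_bounded)
  have trans: "(\<lambda>x. \<phi> (x - a)) \<in> test_functions UNIV" for a
    using test_function_translate[OF \<phi>, of a UNIV] by simp
  have int: "integrable lebesgue (\<lambda>x. w x * \<phi> (x - a))" for a
    by (rule locally_integrable_times_test[OF w trans])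
  have lip: "\<bar>\<phi> (x - s *\<^sub>R i) - \<phi> x\<bar> \<le> B * \<bar>s\<bar>" for x s
    using field_differentiable_bound[OF convex_UNIV test_function_line_derivative[OF \<phi>, of x i], of B s 0]
      B(2) by simp
  have "((\<lambda>h. ((LINT x|lebesgue. w x * \<phi> (x - (0 + h) *\<^sub>R i)) - (LINT x|lebesgue. w x * \<phi> (x - 0 *\<^sub>R i))) / h)
      \<longlongrightarrow> - (LINT x|lebesgue. w x * frechet_derivative \<phi> (at x) i)) (at 0)"
    unfolding tendsto_at_iff_sequentially o_def
  proof (intro allI impI)
    fix h :: "nat \<Rightarrow> real" assume h: "\<forall>n. h n \<in> UNIV - {0}" "h \<longlonglongrightarrow> 0"
    obtain R where R: "R > 0" "\<And>n. \<bar>h n\<bar> \<le> R"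
      using convergent_imp_Bseq[OF convergentI[OF h(2)]] by (auto simp: Bseq_def)
    obtain r where r: "\<And>x. x \<in> K \<Longrightarrow> norm x \<le> r"
      using compact_imp_bounded[OF K(1)] by (auto simp: bounded_iff)
    let ?K = "cball 0 (r + R) :: 'a set"
    have zero: "\<phi> (x - h n *\<^sub>R i) - \<phi> x = 0" if "x \<notin> ?K" for x n
    proof -
      have "norm x \<le> norm (x - h n *\<^sub>R i) + \<bar>h n\<bar>"
        using norm_triangle_sub[of x "h n *\<^sub>R i"] i by simp
      moreover have "norm x > r + R" using that by simp
      ultimately have "norm (x - h n *\<^sub>R i) > r" "norm x > r" using R(1) R(2)[of n] by linarith+
      then show ?thesis using K(3) r by (metis diff_self not_le)
    qed
    define q where "q n x = w x * ((\<phi> (x - h n *\<^sub>R i) - \<phi> x) / h n)" for n x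
    have "(\<lambda>n. LINT x|lebesgue. q n x) \<longlonglongrightarrow> (LINT x|lebesgue. w x * (- frechet_derivative \<phi> (at x) i))"
    proof (rule integral_dominated_convergence[where w = "\<lambda>x. B * \<bar>indicator ?K x * w x\<bar>"])
      show "(\<lambda>x. w x * (- frechet_derivative \<phi> (at x) i)) \<in> borel_measurable lebesgue"
        using w test_function_measurable[OF test_function_partial[OF \<phi> i]]
        by (intro borel_measurable_times borel_measurable_uminus) (simp_all add: locally_integrable_def)
      show "q n \<in> borel_measurable lebesgue" for n
        using w test_function_measurable[OF \<phi>] test_function_measurable[OF trans[of "h n *\<^sub>R i"]]
        unfolding q_def
        by (intro borel_measurable_times borel_measurable_divide borel_measurable_diff borel_measurable_const)
           (simp_all add: locally_integrable_def)
      show "integrable lebesgue (\<lambda>x. B * \<bar>indicator ?K x * w x\<bar>)"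
        using w by (intro integrable_mult_right integrable_abs) (simp add: locally_integrable_def)
      show "AE x in lebesgue. (\<lambda>n. q n x) \<longlonglongrightarrow> w x * (- frechet_derivative \<phi> (at x) i)"
      proof (rule AE_I2)
        fix x
        have "((\<lambda>h. (\<phi> (x - (0 + h) *\<^sub>R i) - \<phi> (x - 0 *\<^sub>R i)) / h) \<longlongrightarrow> - frechet_derivative \<phi> (at (x - 0 *\<^sub>R i)) i) (at 0)"
          using test_function_line_derivative[OF \<phi>, of x i 0] unfolding DERIV_def .
        then have "(\<lambda>n. (\<phi> (x - h n *\<^sub>R i) - \<phi> x) / h n) \<longlonglongrightarrow> - frechet_derivative \<phi> (at x) i"
          using h unfolding tendsto_at_iff_sequentially o_def by simp
        then show "(\<lambda>n. q n x) \<longlonglongrightarrow> w x * (- frechet_derivative \<phi> (at x) i)"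
          unfolding q_def by (intro tendsto_mult tendsto_const)
      qed
      show "AE x in lebesgue. norm (q n x) \<le> B * \<bar>indicator ?K x * w x\<bar>" for n
      proof (rule AE_I2)
        fix x
        show "norm (q n x) \<le> B * \<bar>indicator ?K x * w x\<bar>"
        proof (cases "x \<in> ?K")
          case True
          have "h n \<noteq> 0" using h(1) by auto
          then have "\<bar>(\<phi> (x - h n *\<^sub>R i) - \<phi> x) / h n\<bar> \<le> B"
            using lip[of x "h n"] by (simp add: divide_le_eq)
          from mult_left_mono[OF this abs_ge_zero[of "w x"]] show ?thesis
            using True by (simp add: q_def abs_mult mult.commute)
        qed (use zero in \<open>simp add: q_def\<close>)
      qed
    qed
    moreover have "(LINT x|lebesgue. q n x) =
        ((LINT x|lebesgue. w x * \<phi> (x - (0 + h n) *\<^sub>R i)) - (LINT x|lebesgue. w x * \<phi> (x - 0 *\<^sub>R i))) / h n" for n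
    proof -
      have "(LINT x|lebesgue. q n x) = (LINT x|lebesgue. (w x * \<phi> (x - h n *\<^sub>R i) - w x * \<phi> (x - 0)) / h n)"
        by (simp add: q_def right_diff_distrib)
      also have "\<dots> = ((LINT x|lebesgue. w x * \<phi> (x - h n *\<^sub>R i)) - (LINT x|lebesgue. w x * \<phi> (x - 0))) / h n"
        using int[of "h n *\<^sub>R i"] int[of 0] by (subst integral_divide_zero) (subst Bochner_Integration.integral_diff, auto)
      finally show ?thesis by simp
    qed
    ultimately show "(\<lambda>n. ((LINT x|lebesgue. w x * \<phi> (x - (0 + h n) *\<^sub>R i)) - (LINT x|lebesgue. w x * \<phi> (x - 0 *\<^sub>R i))) / h n)
        \<longlonglongrightarrow> - (LINT x|lebesgue. w x * frechet_derivative \<phi> (at x) i)"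
      by simp
  qed
  then show ?thesis unfolding DERIV_def .
qed

text \<open>The integral of a translate does not depend on the translation.\<close>

lemma integral_partial_derivative_zero:
  assumes \<phi>: "\<phi> \<in> test_functions \<Omega>" and i: "i \<in> Basis"
  shows "(LINT x|lebesgue. frechet_derivative \<phi> (at x) i) = 0"
proof -
  have "((\<lambda>s. LINT x|lebesgue. 1 * \<phi> (x - s *\<^sub>R i)) has_real_derivative
      - (LINT x|lebesgue. 1 * frechet_derivative \<phi> (at x) i)) (at 0)"
    by (rule translation_derivative[OF locally_integrable_const \<phi> i])
  then have "((\<lambda>s. LINT x|lebesgue. \<phi> x) has_real_derivative
      - (LINT x|lebesgue. frechet_derivative \<phi> (at x) i)) (at 0)"
    by (simp add: integral_translate[OF test_function_measurable[OF \<phi>]])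
  from DERIV_unique[OF this DERIV_const] show ?thesis by simp
qed

lemma test_function_integration_by_parts:
  assumes \<phi>: "\<phi> \<in> test_functions \<Omega>" and \<psi>: "\<psi> \<in> test_functions \<Omega>'" and i: "i \<in> Basis"
  shows "(LINT x|lebesgue. \<phi> x * frechet_derivative \<psi> (at x) i)
    = - (LINT x|lebesgue. frechet_derivative \<phi> (at x) i * \<psi> x)"
proof -
  have prod: "(\<lambda>x. \<phi> x * \<psi> x) \<in> test_functions \<Omega>'"
    by (rule test_function_mult[OF test_functions_C_k[OF \<phi>] \<psi>])
  have "frechet_derivative (\<lambda>x. \<phi> x * \<psi> x) (at x) i
      = \<phi> x * frechet_derivative \<psi> (at x) i + frechet_derivative \<phi> (at x) i * \<psi> x" for x
    using frechet_derivative_at[OF has_derivative_mult[OF test_function_has_derivative[OF \<phi>, of x]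
        test_function_has_derivative[OF \<psi>, of x]]] by metis
  then have "(LINT x|lebesgue. \<phi> x * frechet_derivative \<psi> (at x) i + frechet_derivative \<phi> (at x) i * \<psi> x) = 0"
    using integral_partial_derivative_zero[OF prod i] by simp
  moreover have "integrable lebesgue (\<lambda>x. \<phi> x * frechet_derivative \<psi> (at x) i)"
    by (rule locally_integrable_times_test[OF locally_integrable_L2[OF test_function_L2_UNIV[OF \<phi>]]
          test_function_partial[OF \<psi> i]])
  moreover have "integrable lebesgue (\<lambda>x. frechet_derivative \<phi> (at x) i * \<psi> x)"
    by (rule locally_integrable_times_test[OF locally_integrable_L2[OF test_function_L2_UNIV[OF
          test_function_partial[OF \<phi> i]]] \<psi>])
  ultimately show ?thesis by simp
qed

section \<open>Difference quotients of a weakly differentiable function\<close>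

text \<open>
  In the next two lemmas \<open>p\<close> is the weak derivative on \<open>\<Omega>\<close> of \<open>w\<close> in the direction
  \<open>i\<close>. The derivative at \<open>t\<close> of the integral of \<open>w\<close> against the translate of a test
  function by \<open>t i\<close> is the integral of \<open>p\<close> against that translate, whence the mean value
  theorem bounds the increments by the norm of \<open>p\<close>; density of the test functions then
  replaces them by arbitrary square integrable functions that vanish outside \<open>V\<close>.
\<close>

lemma translation_increment_bound:
  fixes w p :: "'a::euclidean_space \<Rightarrow> real"
  assumes w: "w \<in> L2 UNIV" and p: "p \<in> L2 UNIV" and i: "i \<in> Basis"
    and weak: "\<And>\<phi>. \<phi> \<in> test_functions \<Omega> \<Longrightarrow>
      (LINT x|lebesgue. w x * frechet_derivative \<phi> (at x) i) = - (LINT x|lebesgue. p x * \<phi> x)"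
    and V: "open V" "\<And>x t. x \<in> V \<Longrightarrow> \<bar>t\<bar> < \<delta> \<Longrightarrow> x + t *\<^sub>R i \<in> \<Omega>"
    and h: "\<bar>h\<bar> < \<delta>"
    and \<eta>: "\<eta> \<in> L2 UNIV" "\<And>x. x \<notin> V \<Longrightarrow> \<eta> x = 0"
  shows "\<bar>(LINT x|lebesgue. w x * \<eta> (x - h *\<^sub>R i)) - (LINT x|lebesgue. w x * \<eta> x)\<bar>
    \<le> \<bar>h\<bar> * (sqrt (LINT x|lebesgue. (norm (p x))\<^sup>2) * sqrt (2 * (LINT x|lebesgue. (norm (\<eta> x))\<^sup>2)))"
proof -
  define N where "N f = sqrt (LINT x|lebesgue. (norm (f x))\<^sup>2)" for f :: "'a \<Rightarrow> real"
  have N0: "0 \<le> N f" for f unfolding N_def by (intro real_sqrt_ge_zero integral_nonneg_AE) simp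
  have CS: "\<bar>LINT x|lebesgue. f x * g x\<bar> \<le> N f * N g" if "f \<in> L2 UNIV" "g \<in> L2 UNIV" for f g
    using L2_Cauchy_Schwarz[OF that] by (simp add: N_def lebesgue_on_UNIV_eq inner_real_def)
  have mult_int: "integrable lebesgue (\<lambda>x. f x * g x)" if "f \<in> L2 UNIV" "g \<in> L2 UNIV" for f g :: "'a \<Rightarrow> real"
    using L2_mult_integrable[OF that] by (simp add: lebesgue_on_UNIV_eq)
  define G where "G \<psi> s = (LINT x|lebesgue. w x * \<psi> (x - s *\<^sub>R i))" for \<psi> s
  have test: "\<bar>G \<psi> h - G \<psi> 0\<bar> \<le> \<bar>h\<bar> * (N p * N \<psi>)" if \<psi>: "\<psi> \<in> test_functions V" for \<psi>
  proof -
    have "(G \<psi> has_real_derivative (LINT x|lebesgue. p x * \<psi> (x - t *\<^sub>R i))) (at t within {- \<bar>h\<bar>..\<bar>h\<bar>})"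
      if "t \<in> {- \<bar>h\<bar>..\<bar>h\<bar>}" for t
    proof -
      have t: "\<bar>t\<bar> < \<delta>" using that h by auto
      define \<psi>' where "\<psi>' x = \<psi> (x - t *\<^sub>R i)" for x
      have \<psi>': "\<psi>' \<in> test_functions \<Omega>"
        unfolding \<psi>'_def[abs_def] by (rule test_function_translate[OF \<psi> V(2)[OF _ t]])
      have "((\<lambda>s. LINT x|lebesgue. w x * \<psi>' (x - s *\<^sub>R i)) has_real_derivative
          (LINT x|lebesgue. p x * \<psi>' x)) (at 0)"
        using translation_derivative[OF locally_integrable_L2[OF w] \<psi>' i] weak[OF \<psi>'] by simp
      moreover have "(\<lambda>s. LINT x|lebesgue. w x * \<psi>' (x - s *\<^sub>R i)) = (\<lambda>s. G \<psi> (s + t))"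
        by (simp add: G_def \<psi>'_def scaleR_add_left diff_diff_eq)
      ultimately have "((\<lambda>s. G \<psi> (s + t)) has_real_derivative (LINT x|lebesgue. p x * \<psi>' x)) (at 0)" by simp
      then have "(G \<psi> has_real_derivative (LINT x|lebesgue. p x * \<psi>' x)) (at (0 + t))"
        by (subst DERIV_shift)
      then show ?thesis by (simp add: \<psi>'_def has_field_derivative_at_within)
    qed
    moreover have "norm (LINT x|lebesgue. p x * \<psi> (x - t *\<^sub>R i)) \<le> N p * N \<psi>" for t
      using CS[OF p L2_translate(1)[OF test_function_L2_UNIV[OF \<psi>], of "t *\<^sub>R i"]]
        L2_translate(2)[OF test_function_L2_UNIV[OF \<psi>], of "t *\<^sub>R i"]
      by (simp add: N_def)
    ultimately have "norm (G \<psi> h - G \<psi> 0) \<le> (N p * N \<psi>) * norm (h - 0)"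
      by (intro field_differentiable_bound[where S = "{- \<bar>h\<bar>..\<bar>h\<bar>}"]) auto
    then show ?thesis by (simp add: mult.commute)
  qed
  have "\<exists>\<psi>\<in>test_functions V. (LINT x|lebesgue. (norm (\<eta> x - \<psi> x))\<^sup>2) < inverse (real (Suc n))" for n
    using test_functions_dense[OF V(1) \<eta>] unfolding approximable_def by simp
  then obtain \<psi> where \<psi>: "\<And>n. \<psi> n \<in> test_functions V"
    "\<And>n. (LINT x|lebesgue. (norm (\<eta> x - \<psi> n x))\<^sup>2) < inverse (real (Suc n))"
    by metis
  define d where "d n = (LINT x|lebesgue. (norm (\<eta> x - \<psi> n x))\<^sup>2)" for n
  have d: "d \<longlonglongrightarrow> 0"
  proof (rule tendsto_sandwich[OF _ _ tendsto_const LIMSEQ_inverse_real_of_nat])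
    show "\<forall>\<^sub>F n in sequentially. 0 \<le> d n"
      unfolding d_def by (intro always_eventually allI integral_nonneg_AE) simp
    show "\<forall>\<^sub>F n in sequentially. d n \<le> inverse (real (Suc n))"
      using \<psi>(2) by (intro always_eventually allI) (simp add: d_def less_imp_le)
  qed
  have \<psi>L: "\<psi> n \<in> L2 UNIV" for n by (rule test_function_L2_UNIV[OF \<psi>(1)])
  have G: "(\<lambda>n. G (\<psi> n) s) \<longlonglongrightarrow> G \<eta> s" for s
  proof -
    have b: "norm (G (\<psi> n) s - G \<eta> s) \<le> N w * sqrt (d n)" for n
    proof -
      have "G (\<psi> n) s - G \<eta> s = - (LINT x|lebesgue. w x * (\<eta> (x - s *\<^sub>R i) - \<psi> n (x - s *\<^sub>R i)))"
        using mult_int[OF w L2_translate(1)[OF \<psi>L[of n], of "s *\<^sub>R i"]]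
          mult_int[OF w L2_translate(1)[OF \<eta>(1), of "s *\<^sub>R i"]]
        by (simp add: G_def right_diff_distrib)
      moreover have "N (\<lambda>x. \<eta> (x - s *\<^sub>R i) - \<psi> n (x - s *\<^sub>R i)) = sqrt (d n)"
        using L2_translate(2)[OF L2_diff[OF \<eta>(1) \<psi>L[of n]], of "s *\<^sub>R i"] by (simp add: N_def d_def)
      ultimately show ?thesis
        using CS[OF w L2_translate(1)[OF L2_diff[OF \<eta>(1) \<psi>L[of n]], of "s *\<^sub>R i"]] by simp
    qed
    have "(\<lambda>n. N w * sqrt (d n)) \<longlonglongrightarrow> N w * sqrt 0" by (intro tendsto_intros d)
    then have "(\<lambda>n. N w * sqrt (d n)) \<longlonglongrightarrow> 0" by simp
    then have "(\<lambda>n. G (\<psi> n) s - G \<eta> s) \<longlonglongrightarrow> 0"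
      by (rule Lim_null_comparison[OF always_eventually[OF allI[OF b]]])
    then show ?thesis by (rule LIM_zero_cancel)
  qed
  have "\<bar>G \<eta> h - G \<eta> 0\<bar> \<le> \<bar>h\<bar> * (N p * sqrt (2 * (LINT x|lebesgue. (norm (\<eta> x))\<^sup>2) + 2 * 0))"
  proof -
    have lim1: "(\<lambda>n. \<bar>G (\<psi> n) h - G (\<psi> n) 0\<bar>) \<longlonglongrightarrow> \<bar>G \<eta> h - G \<eta> 0\<bar>"
      by (rule tendsto_rabs[OF tendsto_diff[OF G[of h] G[of 0]]])
    have lim2: "(\<lambda>n. \<bar>h\<bar> * (N p * sqrt (2 * (LINT x|lebesgue. (norm (\<eta> x))\<^sup>2) + 2 * d n)))
        \<longlonglongrightarrow> \<bar>h\<bar> * (N p * sqrt (2 * (LINT x|lebesgue. (norm (\<eta> x))\<^sup>2) + 2 * 0))"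
      by (rule tendsto_mult[OF tendsto_const tendsto_mult[OF tendsto_const
            tendsto_real_sqrt[OF tendsto_add[OF tendsto_const tendsto_mult[OF tendsto_const d]]]]])
    have "\<bar>G (\<psi> n) h - G (\<psi> n) 0\<bar> \<le> \<bar>h\<bar> * (N p * sqrt (2 * (LINT x|lebesgue. (norm (\<eta> x))\<^sup>2) + 2 * d n))" for n
    proof -
      have "(LINT x|lebesgue. (norm (\<psi> n x))\<^sup>2) \<le> 2 * (LINT x|lebesgue. (norm (\<eta> x))\<^sup>2) + 2 * d n"
        using L2_norm_add_le[OF \<eta>(1) L2_diff[OF \<psi>L[of n] \<eta>(1)]]
        by (simp add: lebesgue_on_UNIV_eq d_def power2_commute)
      then have "N (\<psi> n) \<le> sqrt (2 * (LINT x|lebesgue. (norm (\<eta> x))\<^sup>2) + 2 * d n)"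
        unfolding N_def by (rule real_sqrt_le_mono)
      then have "\<bar>h\<bar> * (N p * N (\<psi> n)) \<le> \<bar>h\<bar> * (N p * sqrt (2 * (LINT x|lebesgue. (norm (\<eta> x))\<^sup>2) + 2 * d n))"
        by (intro mult_left_mono N0) auto
      with test[OF \<psi>(1)] show ?thesis by (rule order_trans)
    qed
    then show ?thesis using LIMSEQ_le[OF lim1 lim2] by blast
  qed
  then show ?thesis by (simp add: G_def N_def)
qed

lemma translation_derivative_L2:
  fixes w p :: "'a::euclidean_space \<Rightarrow> real"
  assumes w: "w \<in> L2 UNIV" and p: "p \<in> L2 UNIV" and i: "i \<in> Basis"
    and weak: "\<And>\<phi>. \<phi> \<in> test_functions \<Omega> \<Longrightarrow>
      (LINT x|lebesgue. w x * frechet_derivative \<phi> (at x) i) = - (LINT x|lebesgue. p x * \<phi> x)"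
    and V: "open V" "\<And>x t. x \<in> V \<Longrightarrow> \<bar>t\<bar> < \<delta> \<Longrightarrow> x + t *\<^sub>R i \<in> \<Omega>" and \<delta>: "0 < \<delta>"
    and \<eta>: "\<eta> \<in> L2 UNIV" "\<And>x. x \<notin> V \<Longrightarrow> \<eta> x = 0"
  shows "((\<lambda>h. LINT x|lebesgue. w x * \<eta> (x - h *\<^sub>R i)) has_real_derivative
      (LINT x|lebesgue. p x * \<eta> x)) (at 0)"
  unfolding DERIV_def
proof (rule LIM_I)
  fix r :: real assume r: "0 < r"
  define N where "N f = sqrt (LINT x|lebesgue. (norm (f x))\<^sup>2)" for f :: "'a \<Rightarrow> real"
  have N0: "0 \<le> N f" for f unfolding N_def by (intro real_sqrt_ge_zero integral_nonneg_AE) simp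
  have mult_int: "integrable lebesgue (\<lambda>x. f x * g x)" if "f \<in> L2 UNIV" "g \<in> L2 UNIV" for f g :: "'a \<Rightarrow> real"
    using L2_mult_integrable[OF that] by (simp add: lebesgue_on_UNIV_eq)
  define G where "G \<psi> s = (LINT x|lebesgue. w x * \<psi> (x - s *\<^sub>R i))" for \<psi> s
  \<comment> \<open>The error made by replacing \<open>\<eta>\<close> with a test function at distance \<open>e\<close> is at most
    \<open>2 e N p \<le> r/4\<close> in the difference quotients and \<open>e N p \<le> r/8\<close> in the limit.\<close>
  define e where "e = r / (8 * (N p + 1))"
  have e: "e > 0" using r N0[of p] by (simp add: e_def)
  have Npe: "N p * e \<le> r / 8"
    using r N0[of p] by (simp add: e_def divide_simps)
  obtain \<psi> where \<psi>: "\<psi> \<in> test_functions V" "(LINT x|lebesgue. (norm (\<eta> x - \<psi> x))\<^sup>2) < e\<^sup>2"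
    using test_functions_dense[OF V(1) \<eta>] e unfolding approximable_def by (meson zero_less_power)
  have \<psi>L: "\<psi> \<in> L2 UNIV" by (rule test_function_L2_UNIV[OF \<psi>(1)])
  define \<rho> where "\<rho> x = \<eta> x - \<psi> x" for x
  have \<rho>: "\<rho> \<in> L2 UNIV" "\<And>x. x \<notin> V \<Longrightarrow> \<rho> x = 0"
    using L2_diff[OF \<eta>(1) \<psi>L] \<eta>(2) test_function_outside[OF \<psi>(1)] by (simp_all add: \<rho>_def[abs_def])
  have N\<rho>: "N \<rho> \<le> e"
    unfolding N_def using \<psi>(2) e by (intro real_le_lsqrt) (simp_all add: \<rho>_def)
  have "sqrt (2 * (LINT x|lebesgue. (norm (\<rho> x))\<^sup>2)) = sqrt 2 * N \<rho>"
    by (simp add: N_def real_sqrt_mult)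
  also have "\<dots> \<le> 2 * e"
    using N\<rho> N0[of \<rho>] real_sqrt_le_mono[of 2 4] by (intro mult_mono) auto
  finally have sq: "N p * sqrt (2 * (LINT x|lebesgue. (norm (\<rho> x))\<^sup>2)) \<le> N p * (2 * e)"
    by (intro mult_left_mono N0)
  have G_add: "G \<eta> h = G \<rho> h + G \<psi> h" for h
    using mult_int[OF w L2_translate(1)[OF \<psi>L, of "h *\<^sub>R i"]] mult_int[OF w L2_translate(1)[OF \<eta>(1), of "h *\<^sub>R i"]]
    by (simp add: G_def \<rho>_def right_diff_distrib)
  have p_add: "(LINT x|lebesgue. p x * \<eta> x) = (LINT x|lebesgue. p x * \<rho> x) + (LINT x|lebesgue. p x * \<psi> x)"
    using mult_int[OF p \<psi>L] mult_int[OF p \<eta>(1)] by (simp add: \<rho>_def right_diff_distrib)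
  have "\<bar>LINT x|lebesgue. p x * \<rho> x\<bar> \<le> N p * N \<rho>"
    using L2_Cauchy_Schwarz[OF p \<rho>(1)] by (simp add: N_def lebesgue_on_UNIV_eq inner_real_def)
  also have "\<dots> \<le> N p * e" by (intro mult_left_mono N\<rho> N0)
  finally have p\<rho>: "\<bar>LINT x|lebesgue. p x * \<rho> x\<bar> \<le> r / 8" using Npe by linarith
  have "V \<subseteq> \<Omega>" using V(2)[of _ 0] \<delta> by auto
  then have \<psi>\<Omega>: "\<psi> \<in> test_functions \<Omega>" using \<psi>(1) test_functions_mono by blast
  have "((\<lambda>h. (G \<psi> (0 + h) - G \<psi> 0) / h) \<longlongrightarrow> (LINT x|lebesgue. p x * \<psi> x)) (at 0)"
    using translation_derivative[OF locally_integrable_L2[OF w] \<psi>\<Omega> i] weak[OF \<psi>\<Omega>]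
    unfolding DERIV_def G_def by simp
  from LIM_D[OF this, of "r / 4"] r obtain s where s: "s > 0"
    "\<And>h. h \<noteq> 0 \<Longrightarrow> \<bar>h\<bar> < s \<Longrightarrow> \<bar>(G \<psi> (0 + h) - G \<psi> 0) / h - (LINT x|lebesgue. p x * \<psi> x)\<bar> < r / 4"
    by auto
  have "\<bar>(G \<eta> (0 + h) - G \<eta> 0) / h - (LINT x|lebesgue. p x * \<eta> x)\<bar> < r" if h: "h \<noteq> 0" "\<bar>h\<bar> < min s \<delta>" for h
  proof -
    have "\<bar>G \<rho> h - G \<rho> 0\<bar> \<le> \<bar>h\<bar> * (N p * sqrt (2 * (LINT x|lebesgue. (norm (\<rho> x))\<^sup>2)))"
      using translation_increment_bound[where h = h and \<delta> = \<delta>, OF w p i weak V(1) V(2) _ \<rho>] h by (simp add: G_def N_def)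
    also have "\<dots> \<le> \<bar>h\<bar> * (r / 4)"
      using sq Npe by (intro mult_left_mono) auto
    finally have "\<bar>(G \<rho> h - G \<rho> 0) / h\<bar> \<le> r / 4" using h by (simp add: divide_le_eq mult.commute)
    moreover have "\<bar>(G \<psi> h - G \<psi> 0) / h - (LINT x|lebesgue. p x * \<psi> x)\<bar> < r / 4"
      using s(2)[of h] h by simp
    moreover have "(G \<eta> h - G \<eta> 0) / h = (G \<rho> h - G \<rho> 0) / h + (G \<psi> h - G \<psi> 0) / h"
      by (simp add: G_add add_divide_distrib[symmetric])
    ultimately show ?thesis unfolding add_0_left using p\<rho> p_add r by linarith
  qed
  then show "\<exists>s>0. \<forall>h. h \<noteq> 0 \<and> norm (h - 0) < s \<longrightarrow>
      norm (((LINT x|lebesgue. w x * \<eta> (x - (0 + h) *\<^sub>R i)) - (LINT x|lebesgue. w x * \<eta> (x - 0 *\<^sub>R i))) / h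
        - (LINT x|lebesgue. p x * \<eta> x)) < r"
    using s(1) \<delta> by (intro exI[of _ "min s \<delta>"]) (simp add: G_def)
qed

section \<open>Weak gradients\<close>

lemma integral_lebesgue_on_times:
  fixes f \<psi> :: "'a::euclidean_space \<Rightarrow> real"
  assumes "\<Omega> \<in> sets lebesgue"
  shows "(LINT x|lebesgue_on \<Omega>. f x * \<psi> x) = (LINT x|lebesgue. (indicator \<Omega> x * f x) * \<psi> x)"
  using integral_lebesgue_on_indicator[OF assms, of "\<lambda>x. f x * \<psi> x"] by (simp add: mult.assoc)

lemma has_weak_gradient_extended:
  assumes "\<Omega> \<in> sets lebesgue"
  shows "has_weak_gradient \<Omega> u g \<longleftrightarrow> g \<in> L2 \<Omega> \<and> (\<forall>\<phi>\<in>test_functions \<Omega>. \<forall>i\<in>Basis.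
    (LINT x|lebesgue. (indicator \<Omega> x * u x) * frechet_derivative \<phi> (at x) i) =
      - (LINT x|lebesgue. (indicator \<Omega> x * (g x \<bullet> i)) * \<phi> x))"
  unfolding has_weak_gradient_def integral_lebesgue_on_times[OF assms] ..

lemma has_weak_gradient_L2: "has_weak_gradient \<Omega> u g \<Longrightarrow> g \<in> L2 \<Omega>"
  by (simp add: has_weak_gradient_def)

lemma has_weak_gradient_add:
  assumes \<Omega>: "open \<Omega>" and u: "u \<in> L2 \<Omega>" "has_weak_gradient \<Omega> u g"
    and v: "v \<in> L2 \<Omega>" "has_weak_gradient \<Omega> v h"
  shows "has_weak_gradient \<Omega> (\<lambda>x. u x + v x) (\<lambda>x. g x + h x)"
  unfolding has_weak_gradient_def
proof (intro conjI ballI)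
  note gL = has_weak_gradient_L2[OF u(2)] and hL = has_weak_gradient_L2[OF v(2)]
  show "(\<lambda>x. g x + h x) \<in> L2 \<Omega>" by (rule L2_add[OF gL hL])
  fix \<phi> and i :: 'a assume \<phi>: "\<phi> \<in> test_functions \<Omega>" and i: "i \<in> Basis"
  have \<phi>L: "\<phi> \<in> L2 \<Omega>" and dL: "(\<lambda>x. frechet_derivative \<phi> (at x) i) \<in> L2 \<Omega>"
    using \<Omega> test_function_L2[OF \<phi>] test_function_L2[OF test_function_partial[OF \<phi> i]] by auto
  have "(LINT x|lebesgue_on \<Omega>. u x * frechet_derivative \<phi> (at x) i) = - (LINT x|lebesgue_on \<Omega>. (g x \<bullet> i) * \<phi> x)"
    "(LINT x|lebesgue_on \<Omega>. v x * frechet_derivative \<phi> (at x) i) = - (LINT x|lebesgue_on \<Omega>. (h x \<bullet> i) * \<phi> x)"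
    using u(2) v(2) \<phi> i by (simp_all add: has_weak_gradient_def)
  then show "(LINT x|lebesgue_on \<Omega>. (u x + v x) * frechet_derivative \<phi> (at x) i) =
      - (LINT x|lebesgue_on \<Omega>. ((g x + h x) \<bullet> i) * \<phi> x)"
    using L2_mult_integrable[OF u(1) dL] L2_mult_integrable[OF v(1) dL]
      L2_mult_integrable[OF L2_inner_const[OF gL, of i] \<phi>L] L2_mult_integrable[OF L2_inner_const[OF hL, of i] \<phi>L]
    by (simp add: distrib_right inner_add_left)
qed

lemma has_weak_gradient_scale:
  assumes "has_weak_gradient \<Omega> u g"
  shows "has_weak_gradient \<Omega> (\<lambda>x. c * u x) (\<lambda>x. c *\<^sub>R g x)"
  using assms by (auto simp: has_weak_gradient_def L2_scale mult.assoc)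

lemma has_weak_gradient_diff:
  assumes "open \<Omega>" "u \<in> L2 \<Omega>" "has_weak_gradient \<Omega> u g" "v \<in> L2 \<Omega>" "has_weak_gradient \<Omega> v h"
  shows "has_weak_gradient \<Omega> (\<lambda>x. u x - v x) (\<lambda>x. g x - h x)"
  using has_weak_gradient_add[OF assms(1-3) L2_real_scale[OF assms(4)] has_weak_gradient_scale[OF assms(5)],
      of "-1"] by simp

lemma test_function_has_weak_gradient:
  assumes \<phi>: "\<phi> \<in> test_functions \<Omega>'" and \<Omega>: "open \<Omega>"
  shows "has_weak_gradient \<Omega> \<phi> (\<lambda>x. \<Sum>j\<in>Basis. frechet_derivative \<phi> (at x) j *\<^sub>R j)"
proof -
  have comp: "(\<Sum>j\<in>Basis. frechet_derivative \<phi> (at x) j *\<^sub>R j) \<bullet> i = frechet_derivative \<phi> (at x) i"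
    if "i \<in> Basis" for x and i :: 'a
    using that by simp
  have sum_L2: "(\<lambda>x. \<Sum>j\<in>J. frechet_derivative \<phi> (at x) j *\<^sub>R j) \<in> L2 \<Omega>"
    if "finite J" "J \<subseteq> Basis" for J
    using that
  proof (induction J rule: finite_induct)
    case empty
    show ?case by (simp add: L2_def)
  next
    case (insert j J)
    have d: "(\<lambda>x. frechet_derivative \<phi> (at x) j) \<in> L2 \<Omega>"
      using \<Omega> insert.prems by (intro test_function_L2[OF test_function_partial[OF \<phi>]]) auto
    have "(\<lambda>x. frechet_derivative \<phi> (at x) j *\<^sub>R j) \<in> L2 \<Omega>"
      using L2_measurable[OF d] L2_integrable[OF d] insert.prems
      by (intro L2_dominated[OF d]) auto
    then show ?case
      using insert L2_add by simp
  qed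
  show ?thesis
    unfolding has_weak_gradient_def
  proof (intro conjI ballI)
    show "(\<lambda>x. \<Sum>j\<in>Basis. frechet_derivative \<phi> (at x) j *\<^sub>R j) \<in> L2 \<Omega>" by (rule sum_L2) auto
    fix \<psi> and i :: 'a assume \<psi>: "\<psi> \<in> test_functions \<Omega>" and i: "i \<in> Basis"
    have "indicator \<Omega> x * a * \<psi> x = a * \<psi> x"
      "indicator \<Omega> x * a * frechet_derivative \<psi> (at x) i = a * frechet_derivative \<psi> (at x) i" for a x
      using test_function_outside[OF \<psi>, of x] test_function_outside[OF test_function_partial[OF \<psi> i], of x]
      by (auto simp: indicator_def)
    then show "(LINT x|lebesgue_on \<Omega>. \<phi> x * frechet_derivative \<psi> (at x) i) =
        - (LINT x|lebesgue_on \<Omega>. ((\<Sum>j\<in>Basis. frechet_derivative \<phi> (at x) j *\<^sub>R j) \<bullet> i) * \<psi> x)"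
      using test_function_integration_by_parts[OF \<phi> \<psi> i]
      by (simp only: comp[OF i] integral_lebesgue_on_times[OF open_sets_lebesgue[OF \<Omega>]])
  qed
qed

lemma fundamental_lemma_of_variations:
  assumes V: "open V" and f: "f \<in> L2 UNIV" "\<And>x. x \<notin> V \<Longrightarrow> f x = 0"
    and orth: "\<And>\<phi>. \<phi> \<in> test_functions V \<Longrightarrow> (LINT x|lebesgue. f x * \<phi> x) = 0"
  shows "AE x in lebesgue. f x = 0"
proof -
  define a where "a = (LINT x|lebesgue. (norm (f x))\<^sup>2)"
  have a0: "0 \<le> a" unfolding a_def by (rule integral_nonneg_AE) simp
  have "a \<le> sqrt a * e" if e: "e > 0" for e
  proof -
    obtain \<psi> where \<psi>: "\<psi> \<in> test_functions V" "(LINT x|lebesgue. (norm (f x - \<psi> x))\<^sup>2) < e\<^sup>2"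
      using test_functions_dense[OF V f] e unfolding approximable_def by (meson zero_less_power)
    have \<psi>L: "\<psi> \<in> L2 UNIV" by (rule test_function_L2_UNIV[OF \<psi>(1)])
    have i1: "integrable lebesgue (\<lambda>x. f x * \<psi> x)"
      using L2_mult_integrable[OF f(1) \<psi>L] by (simp add: lebesgue_on_UNIV_eq)
    have i2: "integrable lebesgue (\<lambda>x. f x * f x)"
      using L2_mult_integrable[OF f(1) f(1)] by (simp add: lebesgue_on_UNIV_eq)
    have "a = (LINT x|lebesgue. f x * (f x - \<psi> x))"
      using orth[OF \<psi>(1)] i1 i2 by (simp add: a_def right_diff_distrib power2_eq_square)
    also have "\<dots> \<le> sqrt a * sqrt (LINT x|lebesgue. (norm (f x - \<psi> x))\<^sup>2)"
      using L2_Cauchy_Schwarz[OF f(1) L2_diff[OF f(1) \<psi>L]]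
      by (simp add: a_def lebesgue_on_UNIV_eq inner_real_def)
    also have "\<dots> \<le> sqrt a * e"
      using \<psi>(2) e by (intro mult_left_mono real_le_lsqrt) (auto simp: a0)
    finally show ?thesis .
  qed
  then have "a \<le> 0"
  proof (cases "a = 0")
    case False
    then have "a > 0" using a0 by simp
    then have "a \<le> sqrt a * (sqrt a / 2)" using \<open>\<And>e. e > 0 \<Longrightarrow> a \<le> sqrt a * e\<close>[of "sqrt a / 2"] by simp
    also have "\<dots> = a / 2" using a0 by simp
    finally show ?thesis by simp
  qed simp
  with a0 have "a = 0" by simp
  then have "AE x in lebesgue. (norm (f x))\<^sup>2 = 0"
    unfolding a_def using L2_UNIV_integrable[OF f(1)]
    by (subst (asm) integral_nonneg_eq_0_iff_AE) auto
  then show ?thesis by simp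
qed

lemma weak_gradient_unique:
  assumes \<Omega>: "open \<Omega>" and g: "has_weak_gradient \<Omega> u g" and h: "has_weak_gradient \<Omega> u h"
  shows "AE x in lebesgue_on \<Omega>. g x = h x"
proof -
  have gL: "g \<in> L2 \<Omega>" and hL: "h \<in> L2 \<Omega>"
    using g h by (auto simp: has_weak_gradient_def)
  have "AE x in lebesgue. indicator \<Omega> x * ((g x - h x) \<bullet> i) = 0" if i: "i \<in> Basis" for i
  proof (rule fundamental_lemma_of_variations[OF \<Omega>])
    show "(\<lambda>x. indicator \<Omega> x * ((g x - h x) \<bullet> i)) \<in> L2 UNIV"
      using L2_inner_const[OF L2_diff[OF gL hL], of i] L2_extend_zero[of \<Omega> "\<lambda>x. (g x - h x) \<bullet> i"] \<Omega> by simp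
    fix \<phi> assume \<phi>: "\<phi> \<in> test_functions \<Omega>"
    have \<phi>L: "\<phi> \<in> L2 \<Omega>" using \<phi> \<Omega> by (simp add: test_function_L2)
    have "(LINT x|lebesgue_on \<Omega>. (g x \<bullet> i) * \<phi> x) = (LINT x|lebesgue_on \<Omega>. (h x \<bullet> i) * \<phi> x)"
      using g h \<phi> i by (simp add: has_weak_gradient_def)
    then have "(LINT x|lebesgue_on \<Omega>. ((g x - h x) \<bullet> i) * \<phi> x) = 0"
      using L2_mult_integrable[OF L2_inner_const[OF gL, of i] \<phi>L] L2_mult_integrable[OF L2_inner_const[OF hL, of i] \<phi>L]
      by (simp add: inner_diff_left left_diff_distrib)
    then show "(LINT x|lebesgue. (indicator \<Omega> x * ((g x - h x) \<bullet> i)) * \<phi> x) = 0"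
      using integral_lebesgue_on_times[of \<Omega> "\<lambda>x. (g x - h x) \<bullet> i" \<phi>] \<Omega> by simp
  qed simp
  then have "AE x in lebesgue. \<forall>i\<in>Basis. indicator \<Omega> x * ((g x - h x) \<bullet> i) = 0"
    by (intro AE_finite_allI) auto
  then have "AE x in lebesgue. x \<in> \<Omega> \<longrightarrow> g x = h x"
  proof eventually_elim
    case (elim x)
    then show ?case by (auto intro!: euclidean_eqI[of "g x"] simp: inner_diff_left)
  qed
  then show ?thesis using \<Omega> by (simp add: AE_restrict_space_iff)
qed

section \<open>The positive part of a weakly differentiable function\<close>

text \<open>
  Let \<open>A h\<close> and \<open>B h\<close> be the integrals of \<open>max 0 (w - l)\<close> and \<open>w\<close> against the
  translates by \<open>h i\<close> of \<open>\<phi>\<close> and of \<open>\<eta> = \<phi> 1{w > l}\<close>. Since \<open>1{w > l}\<close> is a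
  subgradient of the convex function \<open>max 0 (\<cdot> - l)\<close> at \<open>w\<close>, and \<open>\<phi> \<ge> 0\<close>, the
  difference \<open>A - B\<close> has a minimum at \<open>0\<close>. Both functions are differentiable there, so that
  their derivatives agree; no regularization of \<open>w\<close> or of the positive part is needed.
\<close>

lemma positive_part_weak_derivative_nonneg:
  fixes w p :: "'a::euclidean_space \<Rightarrow> real"
  assumes w: "w \<in> L2 UNIV" and p: "p \<in> L2 UNIV" and i: "i \<in> Basis" and \<Omega>: "open \<Omega>"
    and weak: "\<And>\<phi>. \<phi> \<in> test_functions \<Omega> \<Longrightarrow>
      (LINT x|lebesgue. w x * frechet_derivative \<phi> (at x) i) = - (LINT x|lebesgue. p x * \<phi> x)"
    and \<phi>: "\<phi> \<in> test_functions \<Omega>" and nonneg: "\<And>x. 0 \<le> \<phi> x"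
  shows "(LINT x|lebesgue. max 0 (w x - l) * frechet_derivative \<phi> (at x) i) =
    - (LINT x|lebesgue. (indicator {x. l < w x} x * p x) * \<phi> x)"
proof -
  have wm: "w \<in> borel_measurable lebesgue" by (rule L2_UNIV_measurable[OF w])
  obtain K where K: "compact K" "K \<subseteq> \<Omega>" "\<And>x. x \<notin> K \<Longrightarrow> \<phi> x = 0"
    using \<phi> by (meson test_functionsE)
  obtain e where e: "e > 0" "(\<Union>x\<in>K. ball x e) \<subseteq> \<Omega>"
    using compact_subset_open_imp_ball_epsilon_subset[OF K(1) \<Omega> K(2)] by blast
  define V where "V = (\<Union>x\<in>K. ball x (e / 2))"
  have V: "open V" "\<And>x t. x \<in> V \<Longrightarrow> \<bar>t\<bar> < e / 2 \<Longrightarrow> x + t *\<^sub>R i \<in> \<Omega>"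
  proof -
    show "open V" by (auto simp: V_def)
    fix x t assume "x \<in> V" "\<bar>t\<bar> < e / 2"
    then obtain k where k: "k \<in> K" "dist k x < e / 2" by (auto simp: V_def)
    have "dist x (x + t *\<^sub>R i) < e / 2" using \<open>\<bar>t\<bar> < e / 2\<close> i by (simp add: dist_norm)
    then have "dist k (x + t *\<^sub>R i) < e" using k(2) dist_triangle[of k "x + t *\<^sub>R i" x] by linarith
    then have "x + t *\<^sub>R i \<in> ball k e" by simp
    then show "x + t *\<^sub>R i \<in> \<Omega>" using k(1) e(2) by blast
  qed
  \<comment> \<open>\<open>V\<close> contains the support of \<open>\<phi>\<close>, and its translates by less than \<open>e/2\<close> stay in \<open>\<Omega>\<close>.\<close>
  have KV: "K \<subseteq> V" using e(1) by (auto simp: V_def)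
  define S where "S = {x. l < w x}"
  have S: "S \<in> sets lebesgue"
    using borel_measurable_less[OF borel_measurable_const wm, of l] by (simp add: S_def)
  define \<eta> where "\<eta> x = indicator S x * \<phi> x" for x
  have \<phi>L: "\<phi> \<in> L2 UNIV" by (rule test_function_L2_UNIV[OF \<phi>])
  have \<eta>L: "\<eta> \<in> L2 UNIV"
    unfolding \<eta>_def[abs_def] using S
    by (intro L2_bounded_mult[OF \<phi>L, where B = 1, simplified]) (auto simp: lebesgue_on_UNIV_eq)
  have \<eta>V: "\<eta> x = 0" if "x \<notin> V" for x
    using that KV K(3) by (auto simp: \<eta>_def)
  define f where "f x = max 0 (w x - l)" for x
  have fm: "f \<in> borel_measurable lebesgue" unfolding f_def using wm by measurable
  have wloc: "locally_integrable (\<lambda>x. \<bar>w x\<bar> + \<bar>l\<bar>)"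
    using wm by (intro locally_integrable_add locally_integrable_const
        locally_integrable_bound[OF locally_integrable_L2[OF w]]) auto
  have f_loc: "locally_integrable f"
    by (rule locally_integrable_bound[OF wloc fm]) (auto simp: f_def)
  define A where "A h = (LINT x|lebesgue. f x * \<phi> (x - h *\<^sub>R i))" for h
  define B where "B h = (LINT x|lebesgue. w x * \<eta> (x - h *\<^sub>R i))" for h
  have dA: "(A has_real_derivative - (LINT x|lebesgue. f x * frechet_derivative \<phi> (at x) i)) (at 0)"
    unfolding A_def[abs_def] by (rule translation_derivative[OF f_loc \<phi> i])
  have dB: "(B has_real_derivative (LINT x|lebesgue. p x * \<eta> x)) (at 0)"
    unfolding B_def[abs_def]
    by (rule translation_derivative_L2[where \<Omega> = \<Omega> and V = V and \<delta> = "e / 2", OF w p i weak V _ \<eta>L \<eta>V])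
       (use e(1) in auto)
  have trans: "(\<lambda>x. \<phi> (x - a)) \<in> test_functions UNIV" for a
    using test_function_translate[OF \<phi>, of a UNIV] by simp
  have intA: "integrable lebesgue (\<lambda>x. f x * \<phi> (x - a))" for a
    by (rule locally_integrable_times_test[OF f_loc trans])
  have intB: "integrable lebesgue (\<lambda>x. w x * \<eta> (x - a))" for a
    using L2_mult_integrable[OF w L2_translate(1)[OF \<eta>L, of a]] by (simp add: lebesgue_on_UNIV_eq)
  have int: "integrable lebesgue (\<lambda>x. f x * \<phi> (x - a) - w x * \<eta> (x - a))" for a
    by (rule Bochner_Integration.integrable_diff[OF intA intB])
  have "A 0 - B 0 \<le> A h - B h" for h
  proof -
    define q where "q x = f x * \<phi> (x - h *\<^sub>R i) - w x * \<eta> (x - h *\<^sub>R i)" for x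
    have q_int: "integrable lebesgue q" unfolding q_def[abs_def] by (rule int)
    have qm: "q \<in> borel_measurable lebesgue" by (rule borel_measurable_integrable[OF q_int])
    have "A 0 - B 0 = (LINT x|lebesgue. f x * \<phi> x - w x * \<eta> x)"
      using intA[of 0] intB[of 0] by (simp add: A_def B_def)
    also have "\<dots> \<le> (LINT x|lebesgue. q (x - (- (h *\<^sub>R i))))"
    proof (rule integral_mono)
      show "integrable lebesgue (\<lambda>x. f x * \<phi> x - w x * \<eta> x)" using int[of 0] by simp
      show "integrable lebesgue (\<lambda>x. q (x - (- (h *\<^sub>R i))))"
        using integrable_translate[OF qm] q_int by blast
      fix x
      \<comment> \<open>the subgradient inequality\<close>
      have "f x - w x * indicator S x \<le> f (x + h *\<^sub>R i) - w (x + h *\<^sub>R i) * indicator S x"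
        by (auto simp: f_def S_def indicator_def max_def)
      from mult_right_mono[OF this nonneg[of x]]
      show "f x * \<phi> x - w x * \<eta> x \<le> q (x - (- (h *\<^sub>R i)))"
        by (simp add: q_def \<eta>_def algebra_simps)
    qed
    also have "\<dots> = (LINT x|lebesgue. q x)" by (rule integral_translate[OF qm])
    also have "\<dots> = A h - B h"
      unfolding q_def A_def B_def by (rule Bochner_Integration.integral_diff[OF intA intB])
    finally show ?thesis .
  qed
  then have "- (LINT x|lebesgue. f x * frechet_derivative \<phi> (at x) i) - (LINT x|lebesgue. p x * \<eta> x) = 0"
    by (intro DERIV_local_min[OF DERIV_diff[OF dA dB], of 1]) auto
  then show ?thesis by (simp add: f_def \<eta>_def S_def mult_ac)
qed

text \<open>An arbitrary test function is the difference of two nonnegative ones.\<close>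

lemma positive_part_weak_derivative:
  fixes w p :: "'a::euclidean_space \<Rightarrow> real"
  assumes w: "w \<in> L2 UNIV" and p: "p \<in> L2 UNIV" and i: "i \<in> Basis" and \<Omega>: "open \<Omega>"
    and weak: "\<And>\<phi>. \<phi> \<in> test_functions \<Omega> \<Longrightarrow>
      (LINT x|lebesgue. w x * frechet_derivative \<phi> (at x) i) = - (LINT x|lebesgue. p x * \<phi> x)"
    and \<phi>: "\<phi> \<in> test_functions \<Omega>"
  shows "(LINT x|lebesgue. max 0 (w x - l) * frechet_derivative \<phi> (at x) i) =
    - (LINT x|lebesgue. (indicator {x. l < w x} x * p x) * \<phi> x)"
proof -
  have wm: "w \<in> borel_measurable lebesgue" by (rule L2_UNIV_measurable[OF w])
  obtain K where K: "compact K" "K \<subseteq> \<Omega>" "\<And>x. x \<notin> K \<Longrightarrow> \<phi> x = 0"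
    using \<phi> by (meson test_functionsE)
  obtain s where s: "s \<in> test_functions \<Omega>" "\<And>x. 0 \<le> s x" "\<And>x. x \<in> K \<Longrightarrow> 0 < s x"
    using positive_test_function[OF K(1) \<Omega> K(2)] by blast
  obtain b where b: "0 < b" "\<And>x. \<bar>\<phi> x\<bar> \<le> b"
    using \<phi> by (meson test_function_bounded)
  have "\<exists>m>0. \<forall>x\<in>K. m \<le> s x"
  proof (cases "K = {}")
    case False
    from continuous_attains_inf[OF K(1) this test_function_continuous[OF s(1)]] s(3) show ?thesis by blast
  qed (auto intro: exI[of _ 1])
  then obtain m where m: "m > 0" "\<And>x. x \<in> K \<Longrightarrow> m \<le> s x" by blast
  \<comment> \<open>\<open>c s \<ge> b \<ge> - \<phi>\<close> on the support of \<open>\<phi>\<close>\<close>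
  define c where "c = b / m"
  have c: "c > 0" using b m by (simp add: c_def)
  have nonneg: "0 \<le> \<phi> x + c * s x" for x
  proof (cases "x \<in> K")
    case True
    have "c * m \<le> c * s x" using m(2)[OF True] c by simp
    moreover have "c * m = b" using m by (simp add: c_def)
    ultimately show ?thesis using b(2)[of x] by linarith
  qed (use K(3) s(2) c in simp)
  define \<psi> where "\<psi> x = c * s x" for x
  have \<psi>: "\<psi> \<in> test_functions \<Omega>" unfolding \<psi>_def[abs_def] by (rule test_function_scale[OF s(1)])
  have \<phi>\<psi>: "(\<lambda>x. \<phi> x + \<psi> x) \<in> test_functions \<Omega>" by (rule test_function_add[OF \<phi> \<psi>])
  note core = positive_part_weak_derivative_nonneg[OF w p i \<Omega> weak]
  have sum: "(LINT x|lebesgue. max 0 (w x - l) * frechet_derivative (\<lambda>x. \<phi> x + \<psi> x) (at x) i) =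
      - (LINT x|lebesgue. (indicator {x. l < w x} x * p x) * (\<phi> x + \<psi> x))"
    by (rule core[OF _ \<phi>\<psi>]) (use nonneg in \<open>auto simp: \<psi>_def\<close>)
  have one: "(LINT x|lebesgue. max 0 (w x - l) * frechet_derivative \<psi> (at x) i) =
      - (LINT x|lebesgue. (indicator {x. l < w x} x * p x) * \<psi> x)"
    by (rule core[OF _ \<psi>]) (use c s(2) in \<open>auto simp: \<psi>_def\<close>)
  have der: "frechet_derivative (\<lambda>x. \<phi> x + \<psi> x) (at x) i
      = frechet_derivative \<phi> (at x) i + frechet_derivative \<psi> (at x) i" for x
    using frechet_derivative_at[OF has_derivative_add[OF test_function_has_derivative[OF \<phi>, of x]
        test_function_has_derivative[OF \<psi>, of x]]] by metis
  have wloc: "locally_integrable (\<lambda>x. \<bar>w x\<bar> + \<bar>l\<bar>)"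
    using wm by (intro locally_integrable_add locally_integrable_const
        locally_integrable_bound[OF locally_integrable_L2[OF w]]) auto
  have f_loc: "locally_integrable (\<lambda>x. max 0 (w x - l))"
    using wm by (intro locally_integrable_bound[OF wloc]) auto
  have S: "{x. l < w x} \<in> sets lebesgue"
    using borel_measurable_less[OF borel_measurable_const wm, of l] by simp
  have p_loc: "locally_integrable (\<lambda>x. indicator {x. l < w x} x * p x)"
    using S L2_UNIV_measurable[OF p]
    by (intro locally_integrable_bound[OF locally_integrable_L2[OF p]] borel_measurable_times
        borel_measurable_indicator) (auto simp: indicator_def)
  show ?thesis
    using sum one
      locally_integrable_times_test[OF f_loc test_function_partial[OF \<phi> i]]
      locally_integrable_times_test[OF f_loc test_function_partial[OF \<psi> i]]
      locally_integrable_times_test[OF p_loc \<phi>] locally_integrable_times_test[OF p_loc \<psi>]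
    by (simp add: der distrib_left)
qed

lemma has_weak_gradient_positive_part:
  assumes \<Omega>: "open \<Omega>" and u: "u \<in> L2 \<Omega>" and g: "has_weak_gradient \<Omega> u g"
  shows "has_weak_gradient \<Omega> (\<lambda>x. max 0 (u x - l)) (\<lambda>x. indicator {x. l < u x} x *\<^sub>R g x)"
proof -
  have gL: "g \<in> L2 \<Omega>" using g by (simp add: has_weak_gradient_def)
  define w where "w x = indicator \<Omega> x * u x" for x
  have w: "w \<in> L2 UNIV"
    using u L2_extend_zero[of \<Omega> u] \<Omega> by (simp add: w_def[abs_def])
  have S: "indicator {x. l < u x} \<in> borel_measurable (lebesgue_on \<Omega>)"
    using borel_measurable_less[OF borel_measurable_const L2_measurable[OF u], of l]
    by (auto intro!: borel_measurable_indicator' simp: Int_def space_restrict_space)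
  show ?thesis
    unfolding has_weak_gradient_extended[OF open_sets_lebesgue[OF \<Omega>]]
  proof (intro conjI ballI)
    show "(\<lambda>x. indicator {x. l < u x} x *\<^sub>R g x) \<in> L2 \<Omega>"
      by (rule L2_bounded_mult[OF gL S, of 1]) simp
    fix \<phi> and i :: 'a assume \<phi>: "\<phi> \<in> test_functions \<Omega>" and i: "i \<in> Basis"
    have p: "(\<lambda>x. indicator \<Omega> x * (g x \<bullet> i)) \<in> L2 UNIV"
      using L2_inner_const[OF gL, of i] L2_extend_zero[of \<Omega> "\<lambda>x. g x \<bullet> i"] \<Omega> by simp
    have weak: "(LINT x|lebesgue. w x * frechet_derivative \<psi> (at x) i) =
        - (LINT x|lebesgue. indicator \<Omega> x * (g x \<bullet> i) * \<psi> x)" if "\<psi> \<in> test_functions \<Omega>" for \<psi>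
      using g that i unfolding has_weak_gradient_extended[OF open_sets_lebesgue[OF \<Omega>]] w_def by blast
    have "indicator \<Omega> x * max 0 (u x - l) * frechet_derivative \<phi> (at x) i
        = max 0 (w x - l) * frechet_derivative \<phi> (at x) i" for x
      using test_function_outside[OF test_function_partial[OF \<phi> i], of x] by (cases "x \<in> \<Omega>") (auto simp: w_def)
    moreover have "indicator \<Omega> x * ((indicator {x. l < u x} x *\<^sub>R g x) \<bullet> i) * \<phi> x
        = indicator {x. l < w x} x * (indicator \<Omega> x * (g x \<bullet> i)) * \<phi> x" for x
      by (cases "x \<in> \<Omega>") (auto simp: w_def indicator_def)
    ultimately show "(LINT x|lebesgue. indicator \<Omega> x * max 0 (u x - l) * frechet_derivative \<phi> (at x) i) =
        - (LINT x|lebesgue. indicator \<Omega> x * ((indicator {x. l < u x} x *\<^sub>R g x) \<bullet> i) * \<phi> x)"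
      using positive_part_weak_derivative[OF w p i \<Omega> weak \<phi>, of l] by (simp only:)
  qed
qed

section \<open>The spaces \<open>H\<^sup>1\<close> and \<open>H\<^sub>0\<^sup>1\<close>\<close>

lemma H1_I: "u \<in> L2 \<Omega> \<Longrightarrow> has_weak_gradient \<Omega> u g \<Longrightarrow> u \<in> H1 \<Omega>"
  by (auto simp: H1_def)

lemma H1_L2: "u \<in> H1 \<Omega> \<Longrightarrow> u \<in> L2 \<Omega>"
  by (simp add: H1_def)

lemma H1_weak_grad: "u \<in> H1 \<Omega> \<Longrightarrow> has_weak_gradient \<Omega> u (weak_grad \<Omega> u)"
  unfolding H1_def weak_grad_def by (auto intro: someI[of "has_weak_gradient \<Omega> u"])

lemma weak_grad_AE_eq:
  "open \<Omega> \<Longrightarrow> has_weak_gradient \<Omega> u g \<Longrightarrow> AE x in lebesgue_on \<Omega>. weak_grad \<Omega> u x = g x"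
  unfolding weak_grad_def by (rule weak_gradient_unique) (auto intro: someI[of "has_weak_gradient \<Omega> u"])

lemma H1_diff:
  assumes "open \<Omega>" "u \<in> H1 \<Omega>" "v \<in> H1 \<Omega>"
  shows "(\<lambda>x. u x - v x) \<in> H1 \<Omega>"
  by (rule H1_I[OF L2_diff[OF H1_L2[OF assms(2)] H1_L2[OF assms(3)]]
        has_weak_gradient_diff[OF assms(1) H1_L2[OF assms(2)] H1_weak_grad[OF assms(2)]
          H1_L2[OF assms(3)] H1_weak_grad[OF assms(3)]]])

lemma H1_add:
  assumes "open \<Omega>" "u \<in> H1 \<Omega>" "v \<in> H1 \<Omega>"
  shows "(\<lambda>x. u x + v x) \<in> H1 \<Omega>"
  by (rule H1_I[OF L2_add[OF H1_L2[OF assms(2)] H1_L2[OF assms(3)]]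
        has_weak_gradient_add[OF assms(1) H1_L2[OF assms(2)] H1_weak_grad[OF assms(2)]
          H1_L2[OF assms(3)] H1_weak_grad[OF assms(3)]]])

lemma H1_scale: "u \<in> H1 \<Omega> \<Longrightarrow> (\<lambda>x. c * u x) \<in> H1 \<Omega>"
  by (rule H1_I[OF L2_real_scale[OF H1_L2] has_weak_gradient_scale[OF H1_weak_grad]])

lemma test_function_H1: "open \<Omega> \<Longrightarrow> \<phi> \<in> test_functions \<Omega> \<Longrightarrow> \<phi> \<in> H1 \<Omega>"
  by (rule H1_I[OF test_function_L2 test_function_has_weak_gradient]) auto

lemma H1_norm_sq:
  assumes \<Omega>: "open \<Omega>" and u: "u \<in> L2 \<Omega>" and g: "has_weak_gradient \<Omega> u g"
  shows "(H1_norm \<Omega> u)\<^sup>2 = (LINT x|lebesgue_on \<Omega>. (norm (u x))\<^sup>2) + (LINT x|lebesgue_on \<Omega>. (norm (g x))\<^sup>2)"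
proof -
  have gL: "g \<in> L2 \<Omega>" by (rule has_weak_gradient_L2[OF g])
  have wL: "weak_grad \<Omega> u \<in> L2 \<Omega>" by (rule has_weak_gradient_L2[OF H1_weak_grad[OF H1_I[OF u g]]])
  have "(LINT x|lebesgue_on \<Omega>. (norm (weak_grad \<Omega> u x))\<^sup>2) = (LINT x|lebesgue_on \<Omega>. (norm (g x))\<^sup>2)"
  proof (rule integral_cong_AE)
    show "AE x in lebesgue_on \<Omega>. (norm (weak_grad \<Omega> u x))\<^sup>2 = (norm (g x))\<^sup>2"
      using weak_grad_AE_eq[OF \<Omega> g] by eventually_elim simp
  qed (use L2_integrable[OF gL] L2_integrable[OF wL] in auto)
  moreover have "0 \<le> (LINT x|lebesgue_on \<Omega>. (norm (u x))\<^sup>2 + (norm (weak_grad \<Omega> u x))\<^sup>2)"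
    by (rule integral_nonneg_AE) simp
  ultimately show ?thesis
    using L2_integrable[OF u] L2_integrable[OF wL] by (simp add: H1_norm_def)
qed

lemma H1_norm_nonneg: "0 \<le> H1_norm \<Omega> u"
  unfolding H1_norm_def by (intro real_sqrt_ge_zero integral_nonneg_AE) simp

text \<open>The triangle inequality, with a constant that does no harm to closedness arguments.\<close>

lemma H1_norm_add_le:
  assumes \<Omega>: "open \<Omega>" and u: "u \<in> H1 \<Omega>" and v: "v \<in> H1 \<Omega>"
  shows "H1_norm \<Omega> (\<lambda>x. u x + v x) \<le> 2 * (H1_norm \<Omega> u + H1_norm \<Omega> v)"
proof -
  note uL = H1_L2[OF u] and vL = H1_L2[OF v] and gu = H1_weak_grad[OF u] and gv = H1_weak_grad[OF v]
  have "(H1_norm \<Omega> (\<lambda>x. u x + v x))\<^sup>2 \<le> 2 * (H1_norm \<Omega> u)\<^sup>2 + 2 * (H1_norm \<Omega> v)\<^sup>2"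
    using L2_norm_add_le[OF uL vL] L2_norm_add_le[OF has_weak_gradient_L2[OF gu] has_weak_gradient_L2[OF gv]]
    unfolding H1_norm_sq[OF \<Omega> L2_add[OF uL vL] has_weak_gradient_add[OF \<Omega> uL gu vL gv]]
      H1_norm_sq[OF \<Omega> uL gu] H1_norm_sq[OF \<Omega> vL gv] by simp
  also have "\<dots> \<le> (2 * (H1_norm \<Omega> u + H1_norm \<Omega> v))\<^sup>2"
  proof -
    have "2 * a\<^sup>2 + 2 * b\<^sup>2 \<le> (2 * (a + b))\<^sup>2" if "0 \<le> a" "0 \<le> b" for a b :: real
    proof -
      have "(2 * (a + b))\<^sup>2 = 2 * a\<^sup>2 + 2 * b\<^sup>2 + (2 * a\<^sup>2 + 2 * b\<^sup>2 + 8 * (a * b))"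
        by (simp add: power2_eq_square algebra_simps)
      then show ?thesis using that by simp
    qed
    then show ?thesis by (simp add: H1_norm_nonneg)
  qed
  finally show ?thesis
    by (rule power2_le_imp_le) (simp add: H1_norm_nonneg)
qed

lemma H1_norm_uminus:
  assumes \<Omega>: "open \<Omega>" and u: "u \<in> H1 \<Omega>"
  shows "H1_norm \<Omega> (\<lambda>x. - u x) = H1_norm \<Omega> u"
proof -
  have "(H1_norm \<Omega> (\<lambda>x. - u x))\<^sup>2 = (H1_norm \<Omega> u)\<^sup>2"
    using H1_norm_sq[OF \<Omega> L2_real_scale[OF H1_L2[OF u]] has_weak_gradient_scale[OF H1_weak_grad[OF u]], of "-1"]
      H1_norm_sq[OF \<Omega> H1_L2[OF u] H1_weak_grad[OF u]] by simp
  then show ?thesis by (simp add: H1_norm_nonneg)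
qed

lemma H10_H1: "u \<in> H10 \<Omega> \<Longrightarrow> u \<in> H1 \<Omega>"
  by (simp add: H10_def)

lemma H10_approx:
  assumes "u \<in> H10 \<Omega>" "0 < \<epsilon>"
  obtains \<phi> where "\<phi> \<in> test_functions \<Omega>" "H1_norm \<Omega> (\<lambda>x. u x - \<phi> x) < \<epsilon>"
  using assms by (auto simp: H10_def)

lemma H10_limit:
  assumes \<Omega>: "open \<Omega>" and u: "u \<in> H1 \<Omega>"
    and lim: "\<And>\<epsilon>. 0 < \<epsilon> \<Longrightarrow> \<exists>v\<in>H10 \<Omega>. H1_norm \<Omega> (\<lambda>x. u x - v x) < \<epsilon>"
  shows "u \<in> H10 \<Omega>"
  unfolding H10_def
proof (intro CollectI conjI allI impI u)
  fix \<epsilon> :: real assume "0 < \<epsilon>"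
  then have e: "0 < \<epsilon> / 4" by simp
  obtain v where v: "v \<in> H10 \<Omega>" "H1_norm \<Omega> (\<lambda>x. u x - v x) < \<epsilon> / 4" using lim[OF e] by blast
  obtain \<phi> where \<phi>: "\<phi> \<in> test_functions \<Omega>" "H1_norm \<Omega> (\<lambda>x. v x - \<phi> x) < \<epsilon> / 4"
    using H10_approx[OF v(1) e] by blast
  have "H1_norm \<Omega> (\<lambda>x. u x - \<phi> x) < \<epsilon>"
    using H1_norm_add_le[OF \<Omega> H1_diff[OF \<Omega> u H10_H1[OF v(1)]]
        H1_diff[OF \<Omega> H10_H1[OF v(1)] test_function_H1[OF \<Omega> \<phi>(1)]]] v(2) \<phi>(2) by simp
  with \<phi>(1) show "\<exists>\<phi>\<in>test_functions \<Omega>. H1_norm \<Omega> (\<lambda>x. u x - \<phi> x) < \<epsilon>" by blast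
qed

lemma H10_add:
  assumes \<Omega>: "open \<Omega>" and u: "u \<in> H10 \<Omega>" and v: "v \<in> H10 \<Omega>"
  shows "(\<lambda>x. u x + v x) \<in> H10 \<Omega>"
  unfolding H10_def
proof (intro CollectI conjI allI impI H1_add \<Omega> H10_H1 u v)
  fix \<epsilon> :: real assume "0 < \<epsilon>"
  then have e: "0 < \<epsilon> / 4" by simp
  obtain \<phi> where \<phi>: "\<phi> \<in> test_functions \<Omega>" "H1_norm \<Omega> (\<lambda>x. u x - \<phi> x) < \<epsilon> / 4"
    using H10_approx[OF u e] by blast
  obtain \<psi> where \<psi>: "\<psi> \<in> test_functions \<Omega>" "H1_norm \<Omega> (\<lambda>x. v x - \<psi> x) < \<epsilon> / 4"
    using H10_approx[OF v e] by blast
  have "H1_norm \<Omega> (\<lambda>x. (u x - \<phi> x) + (v x - \<psi> x)) < \<epsilon>"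
    using H1_norm_add_le[OF \<Omega> H1_diff[OF \<Omega> H10_H1[OF u] test_function_H1[OF \<Omega> \<phi>(1)]]
        H1_diff[OF \<Omega> H10_H1[OF v] test_function_H1[OF \<Omega> \<psi>(1)]]] \<phi>(2) \<psi>(2) by simp
  moreover have "(\<lambda>x. (u x - \<phi> x) + (v x - \<psi> x)) = (\<lambda>x. u x + v x - (\<phi> x + \<psi> x))" by auto
  ultimately show "\<exists>\<phi>\<in>test_functions \<Omega>. H1_norm \<Omega> (\<lambda>x. u x + v x - \<phi> x) < \<epsilon>"
    by (intro bexI[OF _ test_function_add[OF \<phi>(1) \<psi>(1)]]) simp
qed

lemma H10_uminus:
  assumes \<Omega>: "open \<Omega>" and u: "u \<in> H10 \<Omega>"
  shows "(\<lambda>x. - u x) \<in> H10 \<Omega>"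
  unfolding H10_def
proof (intro CollectI conjI allI impI)
  show "(\<lambda>x. - u x) \<in> H1 \<Omega>" using H1_scale[OF H10_H1[OF u], of "-1"] by simp
  fix \<epsilon> :: real assume "0 < \<epsilon>"
  from H10_approx[OF u this] obtain \<phi> where
    \<phi>: "\<phi> \<in> test_functions \<Omega>" "H1_norm \<Omega> (\<lambda>x. u x - \<phi> x) < \<epsilon>" .
  have "H1_norm \<Omega> (\<lambda>x. - u x - (-1) * \<phi> x) < \<epsilon>"
    using H1_norm_uminus[OF \<Omega> H1_diff[OF \<Omega> H10_H1[OF u] test_function_H1[OF \<Omega> \<phi>(1)]]] \<phi>(2)
    by (simp add: add.commute)
  then show "\<exists>\<phi>\<in>test_functions \<Omega>. H1_norm \<Omega> (\<lambda>x. - u x - \<phi> x) < \<epsilon>"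
    by (rule bexI[OF _ test_function_scale[OF \<phi>(1)]])
qed

text \<open>Elements of \<open>H10 \<Omega>\<close> may be tested with functions that do not vanish on the boundary.\<close>

lemma H10_integration_by_parts:
  assumes \<Omega>: "open \<Omega>" and u: "u \<in> H10 \<Omega>" and \<psi>: "\<psi> \<in> test_functions \<Omega>'" and i: "i \<in> Basis"
  shows "(LINT x|lebesgue_on \<Omega>. u x * frechet_derivative \<psi> (at x) i) =
    - (LINT x|lebesgue_on \<Omega>. (weak_grad \<Omega> u x \<bullet> i) * \<psi> x)"
proof -
  define d where "d x = frechet_derivative \<psi> (at x) i" for x
  define R where "R f h = (LINT x|lebesgue_on \<Omega>. f x * d x) + (LINT x|lebesgue_on \<Omega>. (h x \<bullet> i) * \<psi> x)"
    for f :: "'a \<Rightarrow> real" and h :: "'a \<Rightarrow> 'a"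
  define N where "N f = sqrt (LINT x|lebesgue_on \<Omega>. (norm (f x))\<^sup>2)" for f :: "'a \<Rightarrow> real"
  have N0: "0 \<le> N f" for f unfolding N_def by (intro real_sqrt_ge_zero integral_nonneg_AE) simp
  have \<psi>L: "\<psi> \<in> L2 \<Omega>" and dL: "d \<in> L2 \<Omega>"
    using \<Omega> test_function_L2[OF \<psi>] test_function_L2[OF test_function_partial[OF \<psi> i]]
    by (simp_all add: d_def[abs_def])
  have \<psi>iL: "(\<lambda>x. \<psi> x *\<^sub>R i) \<in> L2 \<Omega>"
    using L2_measurable[OF \<psi>L] L2_integrable[OF \<psi>L] i by (intro L2_dominated[OF \<psi>L]) auto
  have bound: "\<bar>R f h\<bar> \<le> H1_norm \<Omega> f * (N d + N \<psi>)" if f: "f \<in> L2 \<Omega>" "has_weak_gradient \<Omega> f h" for f h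
  proof -
    note hL = has_weak_gradient_L2[OF f(2)]
    have nn: "0 \<le> (LINT x|lebesgue_on \<Omega>. (norm (f x))\<^sup>2)" "0 \<le> (LINT x|lebesgue_on \<Omega>. (norm (h x))\<^sup>2)"
      by (rule integral_nonneg_AE, simp)+
    have le: "N f \<le> H1_norm \<Omega> f" "sqrt (LINT x|lebesgue_on \<Omega>. (norm (h x))\<^sup>2) \<le> H1_norm \<Omega> f"
      unfolding N_def using nn H1_norm_sq[OF \<Omega> f] H1_norm_nonneg[of \<Omega> f]
      by (auto intro!: real_le_lsqrt)
    have "\<bar>LINT x|lebesgue_on \<Omega>. f x * d x\<bar> \<le> N f * N d"
      using L2_Cauchy_Schwarz[OF f(1) dL] by (simp add: N_def inner_real_def)
    also have "\<dots> \<le> H1_norm \<Omega> f * N d" by (intro mult_right_mono le N0)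
    finally have 1: "\<bar>LINT x|lebesgue_on \<Omega>. f x * d x\<bar> \<le> H1_norm \<Omega> f * N d" .
    have "\<bar>LINT x|lebesgue_on \<Omega>. (h x \<bullet> i) * \<psi> x\<bar> \<le> sqrt (LINT x|lebesgue_on \<Omega>. (norm (h x))\<^sup>2) * N \<psi>"
      using L2_Cauchy_Schwarz[OF hL \<psi>iL] i by (simp add: N_def mult.commute)
    also have "\<dots> \<le> H1_norm \<Omega> f * N \<psi>" by (intro mult_right_mono le N0)
    finally show ?thesis using 1 by (simp add: R_def distrib_left)
  qed
  have "\<bar>R u (weak_grad \<Omega> u)\<bar> \<le> \<epsilon> * (N d + N \<psi>)" if e: "0 < \<epsilon>" for \<epsilon>
  proof -
    obtain \<phi> where \<phi>: "\<phi> \<in> test_functions \<Omega>" "H1_norm \<Omega> (\<lambda>x. u x - \<phi> x) < \<epsilon>"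
      using H10_approx[OF u e] .
    define g\<phi> where "g\<phi> x = (\<Sum>j\<in>Basis. frechet_derivative \<phi> (at x) j *\<^sub>R j)" for x
    have g\<phi>: "has_weak_gradient \<Omega> \<phi> g\<phi>"
      unfolding g\<phi>_def[abs_def] by (rule test_function_has_weak_gradient[OF \<phi>(1) \<Omega>])
    have \<phi>L: "\<phi> \<in> L2 \<Omega>" using \<Omega> by (simp add: test_function_L2[OF \<phi>(1)])
    have uL: "u \<in> L2 \<Omega>" and gu: "has_weak_gradient \<Omega> u (weak_grad \<Omega> u)"
      using H10_H1[OF u] by (simp_all add: H1_L2 H1_weak_grad)
    have comp: "g\<phi> x \<bullet> i = frechet_derivative \<phi> (at x) i" for x using i by (simp add: g\<phi>_def)
    have "indicator \<Omega> x * \<phi> x * a = \<phi> x * a"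
      "indicator \<Omega> x * frechet_derivative \<phi> (at x) i * a = frechet_derivative \<phi> (at x) i * a" for a x
      using test_function_outside[OF \<phi>(1), of x] test_function_outside[OF test_function_partial[OF \<phi>(1) i], of x]
      by (auto simp: indicator_def)
    then have "R \<phi> g\<phi> = 0"
      using test_function_integration_by_parts[OF \<phi>(1) \<psi> i]
      unfolding R_def d_def comp integral_lebesgue_on_times[OF open_sets_lebesgue[OF \<Omega>]]
      by (simp only: add.left_inverse)
    moreover have "R (\<lambda>x. u x - \<phi> x) (\<lambda>x. weak_grad \<Omega> u x - g\<phi> x) = R u (weak_grad \<Omega> u) - R \<phi> g\<phi>"
      using L2_mult_integrable[OF uL dL] L2_mult_integrable[OF \<phi>L dL]
        L2_mult_integrable[OF L2_inner_const[OF has_weak_gradient_L2[OF gu], of i] \<psi>L]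
        L2_mult_integrable[OF L2_inner_const[OF has_weak_gradient_L2[OF g\<phi>], of i] \<psi>L]
      by (simp add: R_def inner_diff_left left_diff_distrib)
    ultimately have "\<bar>R u (weak_grad \<Omega> u)\<bar> \<le> H1_norm \<Omega> (\<lambda>x. u x - \<phi> x) * (N d + N \<psi>)"
      using bound[OF L2_diff[OF uL \<phi>L] has_weak_gradient_diff[OF \<Omega> uL gu \<phi>L g\<phi>]] by simp
    also have "\<dots> \<le> \<epsilon> * (N d + N \<psi>)"
      using \<phi>(2) N0[of d] N0[of \<psi>] by (intro mult_right_mono) auto
    finally show ?thesis .
  qed
  note small = this
  have "R u (weak_grad \<Omega> u) = 0"
  proof (rule ccontr)
    assume "R u (weak_grad \<Omega> u) \<noteq> 0"
    then have r: "0 < \<bar>R u (weak_grad \<Omega> u)\<bar>" by simp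
    have s: "0 < N d + N \<psi> + 1" using N0[of d] N0[of \<psi>] by simp
    have "\<bar>R u (weak_grad \<Omega> u)\<bar> * (N d + N \<psi> + 1) \<le> \<bar>R u (weak_grad \<Omega> u)\<bar> * (N d + N \<psi>)"
      using small[of "\<bar>R u (weak_grad \<Omega> u)\<bar> / (N d + N \<psi> + 1)"] r s by (simp add: field_simps)
    with r show False by (simp add: distrib_left)
  qed
  then show ?thesis by (simp add: R_def d_def)
qed

text \<open>
  If \<open>w \<ge> \<delta>\<close> on \<open>\<Omega>\<close>, then \<open>\<delta>/2\<close> times the indicator of \<open>\<Omega>\<close>, being the minimum of
  \<open>\<delta>/2\<close> and of the zero extension of \<open>w\<close>, has a vanishing weak gradient on the whole space.
  Its integrals against the translates of a test function on \<open>\<Omega>\<close> are therefore independent of the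
  translation, and they vanish for large ones because \<open>\<Omega>\<close> is bounded. So the indicator is
  orthogonal to all test functions on \<open>\<Omega>\<close>, and \<open>\<Omega>\<close> is a null set.
\<close>

lemma H10_not_bounded_below:
  fixes \<Omega> :: "'a::euclidean_space set"
  assumes \<Omega>: "open \<Omega>" "bounded \<Omega>" "\<Omega> \<noteq> {}" and w: "w \<in> H10 \<Omega>" and \<delta>: "0 < \<delta>"
  shows "\<exists>x\<in>\<Omega>. w x < \<delta>"
proof (rule ccontr)
  assume "\<not> (\<exists>x\<in>\<Omega>. w x < \<delta>)"
  then have bd: "\<delta> \<le> w x" if "x \<in> \<Omega>" for x using that by force
  have \<Omega>l: "\<Omega> \<in> sets lebesgue" using \<Omega>(1) by simp
  define W where "W x = indicator \<Omega> x * w x" for x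
  define g where "g x = indicator \<Omega> x *\<^sub>R weak_grad \<Omega> w x" for x
  note wH = H10_H1[OF w]
  have WL: "W \<in> L2 UNIV"
    using H1_L2[OF wH] L2_extend_zero[OF \<Omega>l, of w] by (simp add: W_def[abs_def])
  have gL: "g \<in> L2 UNIV"
    using has_weak_gradient_L2[OF H1_weak_grad[OF wH]] L2_extend_zero[OF \<Omega>l, of "weak_grad \<Omega> w"]
    by (simp add: g_def[abs_def])
  have gW: "has_weak_gradient UNIV W g"
    unfolding has_weak_gradient_def
  proof (intro conjI ballI gL)
    fix \<psi> :: "'a \<Rightarrow> real" and i :: 'a assume \<psi>: "\<psi> \<in> test_functions UNIV" and i: "i \<in> Basis"
    show "(LINT x|lebesgue_on UNIV. W x * frechet_derivative \<psi> (at x) i) =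
        - (LINT x|lebesgue_on UNIV. (g x \<bullet> i) * \<psi> x)"
      using H10_integration_by_parts[OF \<Omega>(1) w \<psi> i]
      by (simp add: integral_lebesgue_on_times[OF \<Omega>l] lebesgue_on_UNIV_eq W_def g_def)
  qed
  \<comment> \<open>At the level \<open>\<delta>/2\<close>, unlike \<open>\<delta>\<close>, the strict superlevel set contains all of \<open>\<Omega>\<close>.\<close>
  have "(\<lambda>x. indicator {x. \<delta> / 2 < W x} x *\<^sub>R g x) = g"
  proof
    show "indicator {x. \<delta> / 2 < W x} x *\<^sub>R g x = g x" for x
      using bd[of x] \<delta> by (cases "x \<in> \<Omega>") (auto simp: W_def g_def indicator_def)
  qed
  then have gP: "has_weak_gradient UNIV (\<lambda>x. max 0 (W x - \<delta> / 2)) g"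
    using has_weak_gradient_positive_part[OF open_UNIV WL gW, of "\<delta> / 2"] by simp
  have PL: "(\<lambda>x. max 0 (W x - \<delta> / 2)) \<in> L2 UNIV"
    using L2_measurable[OF WL] \<delta> by (intro L2_dominated[OF WL]) auto
  have "(\<lambda>x. W x - max 0 (W x - \<delta> / 2)) = (\<lambda>x. \<delta> / 2 * indicator \<Omega> x)"
  proof
    show "W x - max 0 (W x - \<delta> / 2) = \<delta> / 2 * indicator \<Omega> x" for x
      using bd[of x] \<delta> by (cases "x \<in> \<Omega>") (auto simp: W_def)
  qed
  then have "has_weak_gradient UNIV (\<lambda>x. \<delta> / 2 * indicator \<Omega> x) (\<lambda>x. 0)"
    using has_weak_gradient_diff[OF open_UNIV WL gW PL gP] by simp
  then have "has_weak_gradient UNIV (\<lambda>x. 2 / \<delta> * (\<delta> / 2 * indicator \<Omega> x)) (\<lambda>x. (2 / \<delta>) *\<^sub>R 0)"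
    by (rule has_weak_gradient_scale)
  then have ind: "has_weak_gradient UNIV (indicator \<Omega>) (\<lambda>x. 0)" using \<delta> by simp
  have one: "(\<lambda>x. 1 :: real) \<in> L2 \<Omega>"
    using \<Omega> \<Omega>l by (auto simp: L2_def integrable_restrict_space bounded_set_imp_lmeasurable
        fmeasurable_def intro!: integrable_real_indicator dest: bounded_set_imp_lmeasurable)
  then have indL: "(indicator \<Omega> :: 'a \<Rightarrow> real) \<in> L2 UNIV"
    using L2_extend_zero[OF \<Omega>l, of "\<lambda>x. 1 :: real"] by simp
  obtain r where r: "r > 0" "\<And>x. x \<in> \<Omega> \<Longrightarrow> norm x \<le> r"
    using \<Omega>(2) unfolding bounded_pos by blast
  obtain i :: 'a where i: "i \<in> Basis" using nonempty_Basis by blast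
  have "(LINT x|lebesgue. indicator \<Omega> x * \<phi> x) = 0" if \<phi>: "\<phi> \<in> test_functions \<Omega>" for \<phi>
  proof -
    define G where "G s = (LINT x|lebesgue. indicator \<Omega> x * \<phi> (x - s *\<^sub>R i))" for s :: real
    have "(G has_real_derivative 0) (at t)" for t
    proof -
      define \<psi> where "\<psi> x = \<phi> (x - t *\<^sub>R i)" for x
      have \<psi>: "\<psi> \<in> test_functions UNIV"
        unfolding \<psi>_def[abs_def] by (rule test_function_translate[OF \<phi>]) simp
      have "(LINT x|lebesgue. indicator \<Omega> x * frechet_derivative \<psi> (at x) i) = 0"
        using ind \<psi> i by (simp add: has_weak_gradient_def lebesgue_on_UNIV_eq)
      then have "((\<lambda>s. LINT x|lebesgue. indicator \<Omega> x * \<psi> (x - s *\<^sub>R i)) has_real_derivative 0) (at 0)"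
        using translation_derivative[OF locally_integrable_L2[OF indL] \<psi> i] by simp
      moreover have "(\<lambda>s. LINT x|lebesgue. indicator \<Omega> x * \<psi> (x - s *\<^sub>R i)) = (\<lambda>s. G (s + t))"
        by (simp add: G_def \<psi>_def scaleR_add_left diff_diff_eq)
      ultimately have "(G has_real_derivative 0) (at (0 + t))"
        by (subst DERIV_shift) simp
      then show ?thesis by simp
    qed
    then have "G 0 = G (2 * r + 1)" by (rule DERIV_isconst_all[rule_format])
    moreover have "indicator \<Omega> x * \<phi> (x - (2 * r + 1) *\<^sub>R i) = 0" for x
    proof (cases "x \<in> \<Omega> \<and> x - (2 * r + 1) *\<^sub>R i \<in> \<Omega>")
      case True
      have "norm ((2 * r + 1) *\<^sub>R i) \<le> norm x + norm (x - (2 * r + 1) *\<^sub>R i)"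
        using norm_triangle_ineq4[of x "x - (2 * r + 1) *\<^sub>R i"] by simp
      then have "norm ((2 * r + 1) *\<^sub>R i) \<le> 2 * r" using r(2)[of x] r(2)[of "x - (2 * r + 1) *\<^sub>R i"] True by linarith
      then show ?thesis using i r(1) by simp
    qed (use test_function_outside[OF \<phi>] in auto)
    ultimately show ?thesis by (simp add: G_def)
  qed
  then have "AE x in lebesgue. indicator \<Omega> x = (0::real)"
    by (intro fundamental_lemma_of_variations[OF \<Omega>(1) indL]) auto
  then have "AE x in lebesgue. x \<notin> \<Omega>" by eventually_elim (auto simp: indicator_def split: if_splits)
  then have "\<Omega> \<in> null_sets lebesgue"
    using AE_iff_null_sets[OF \<Omega>l] by simp
  then have "negligible \<Omega>" by (simp add: negligible_iff_null_sets)
  then show False using open_not_negligible[OF \<Omega>(1,3)] by simp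
qed

lemma positive_part_L2:
  assumes "f \<in> L2 \<Omega>" "0 \<le> (l::real)"
  shows "(\<lambda>x. max 0 (f x - l)) \<in> L2 \<Omega>"
  using L2_measurable[OF assms(1)] assms(2) by (intro L2_dominated[OF assms(1)]) auto

lemma positive_part_H10_limit:
  assumes \<Omega>: "open \<Omega>" and U: "U \<in> H1 \<Omega>" and M: "0 \<le> M"
    and l: "\<And>n. M \<le> l n" "l \<longlonglongrightarrow> M" "\<And>n. (\<lambda>x. max 0 (U x - l n)) \<in> H10 \<Omega>"
  shows "(\<lambda>x. max 0 (U x - M)) \<in> H10 \<Omega>"
proof (rule H10_limit[OF \<Omega>])
  note UL = H1_L2[OF U]
  define g where "g = weak_grad \<Omega> U"
  have g: "has_weak_gradient \<Omega> U g" unfolding g_def by (rule H1_weak_grad[OF U])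
  define P where "P m x = max 0 (U x - m)" for m x
  define Q where "Q m x = indicator {x. m < U x} x *\<^sub>R g x" for m x
  have PL: "P m \<in> L2 \<Omega>" if "0 \<le> m" for m
    unfolding P_def[abs_def] by (rule positive_part_L2[OF UL that])
  have Q: "has_weak_gradient \<Omega> (P m) (Q m)" for m
    unfolding P_def[abs_def] Q_def[abs_def] by (rule has_weak_gradient_positive_part[OF \<Omega> UL g])
  have l0: "0 \<le> l n" for n using l(1)[of n] M by simp
  show "(\<lambda>x. max 0 (U x - M)) \<in> H1 \<Omega>"
    using H1_I[OF PL[OF M] Q] by (simp add: P_def[abs_def])
  have conv: "(\<lambda>n. LINT x|lebesgue_on \<Omega>. (norm (f n x))\<^sup>2) \<longlonglongrightarrow> (LINT x|lebesgue_on \<Omega>. 0)"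
    if h: "h \<in> L2 \<Omega>" and f: "\<And>n. f n \<in> L2 \<Omega>" and le: "\<And>n x. norm (f n x) \<le> norm (h x)"
      and lim: "\<And>x. (\<lambda>n. f n x) \<longlonglongrightarrow> 0"
    for h :: "'a \<Rightarrow> 'b::euclidean_space" and f
  proof (rule integral_dominated_convergence[where w = "\<lambda>x. (norm (h x))\<^sup>2"])
    show "integrable (lebesgue_on \<Omega>) (\<lambda>x. (norm (h x))\<^sup>2)" by (rule L2_integrable[OF h])
    show "(\<lambda>x. (norm (f n x))\<^sup>2) \<in> borel_measurable (lebesgue_on \<Omega>)" for n
      using L2_integrable[OF f[of n]] by auto
    show "AE x in lebesgue_on \<Omega>. (\<lambda>n. (norm (f n x))\<^sup>2) \<longlonglongrightarrow> 0"
      using tendsto_power[OF tendsto_norm[OF lim], of _ 2] by simp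
    show "AE x in lebesgue_on \<Omega>. norm ((norm (f n x))\<^sup>2) \<le> (norm (h x))\<^sup>2" for n
      using le by (simp add: power_mono)
  qed simp
  have ev: "\<forall>\<^sub>F n in sequentially. l n < U x" if "M < U x" for x
    by (rule order_tendstoD(2)[OF l(2) that])
  have le_M: "U x \<le> l n" if "\<not> M < U x" for x n using that l(1)[of n] by simp
  have c1: "(\<lambda>n. LINT x|lebesgue_on \<Omega>. (norm (P M x - P (l n) x))\<^sup>2) \<longlonglongrightarrow> (LINT x|lebesgue_on \<Omega>. 0)"
  proof (rule conv[OF UL L2_diff[OF PL[OF M] PL[OF l0]]])
    show "norm (P M x - P (l n) x) \<le> norm (U x)" for n x
      using l(1)[of n] M by (auto simp: P_def)
    show "(\<lambda>n. P M x - P (l n) x) \<longlonglongrightarrow> 0" for x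
    proof -
      have "(\<lambda>n. P M x - P (l n) x) \<longlonglongrightarrow> P M x - max 0 (U x - M)"
        unfolding P_def by (intro tendsto_intros l(2))
      then show ?thesis by (simp add: P_def)
    qed
  qed
  have c2: "(\<lambda>n. LINT x|lebesgue_on \<Omega>. (norm (Q M x - Q (l n) x))\<^sup>2) \<longlonglongrightarrow> (LINT x|lebesgue_on \<Omega>. 0)"
  proof (rule conv[OF has_weak_gradient_L2[OF g] L2_diff[OF has_weak_gradient_L2[OF Q] has_weak_gradient_L2[OF Q]]])
    show "norm (Q M x - Q (l n) x) \<le> norm (g x)" for n x
      using l(1)[of n] by (auto simp: Q_def indicator_def)
    show "(\<lambda>n. Q M x - Q (l n) x) \<longlonglongrightarrow> 0" for x
    proof (cases "M < U x")
      case True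
      have "\<forall>\<^sub>F n in sequentially. Q M x - Q (l n) x = 0"
        using ev[OF True] by eventually_elim (use True in \<open>simp add: Q_def\<close>)
      then show ?thesis by (rule tendsto_eventually)
    next
      case False
      then have "Q M x - Q (l n) x = 0" for n using le_M[OF False, of n] by (simp add: Q_def)
      then show ?thesis by simp
    qed
  qed
  have sq: "(H1_norm \<Omega> (\<lambda>x. P M x - P (l n) x))\<^sup>2 =
      (LINT x|lebesgue_on \<Omega>. (norm (P M x - P (l n) x))\<^sup>2) + (LINT x|lebesgue_on \<Omega>. (norm (Q M x - Q (l n) x))\<^sup>2)" for n
    by (rule H1_norm_sq[OF \<Omega> L2_diff[OF PL[OF M] PL[OF l0]] has_weak_gradient_diff[OF \<Omega> PL[OF M] Q PL[OF l0] Q]])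
  have lim: "(\<lambda>n. (H1_norm \<Omega> (\<lambda>x. P M x - P (l n) x))\<^sup>2) \<longlonglongrightarrow> 0"
    unfolding sq using tendsto_add[OF c1 c2] by simp
  fix \<epsilon> :: real assume e: "0 < \<epsilon>"
  have "\<forall>\<^sub>F n in sequentially. (H1_norm \<Omega> (\<lambda>x. P M x - P (l n) x))\<^sup>2 < \<epsilon>\<^sup>2"
    using e by (intro order_tendstoD(2)[OF lim]) simp
  then obtain n where "(H1_norm \<Omega> (\<lambda>x. P M x - P (l n) x))\<^sup>2 < \<epsilon>\<^sup>2"
    by (auto simp: eventually_sequentially)
  then have "H1_norm \<Omega> (\<lambda>x. P M x - P (l n) x) < \<epsilon>" by (rule power2_less_imp_less) (use e in simp)
  then show "\<exists>v\<in>H10 \<Omega>. H1_norm \<Omega> (\<lambda>x. max 0 (U x - M) - v x) < \<epsilon>"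
    using l(3)[of n] by (auto simp: P_def)
qed

section \<open>The truncation estimate\<close>

lemma boundary_sup_positive_part:
  assumes \<Omega>: "open \<Omega>" "bounded \<Omega>" "\<Omega> \<noteq> {}" and U: "U \<in> H1 \<Omega>"
    and fin: "boundary_sup \<Omega> (\<lambda>x. max 0 (U x)) \<noteq> \<infinity>"
  obtains M where "0 \<le> M" "boundary_sup \<Omega> (\<lambda>x. max 0 (U x)) = ereal M"
    "(\<lambda>x. max 0 (U x - M)) \<in> H10 \<Omega>"
proof -
  define L where "L = {l. (\<lambda>x. max 0 (max 0 (U x) - l)) \<in> H10 \<Omega>}"
  have bs: "boundary_sup \<Omega> (\<lambda>x. max 0 (U x)) = Inf (ereal ` L)"
    by (simp add: boundary_sup_def L_def)
  have nonneg: "0 \<le> l" if "l \<in> L" for l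
  proof (rule ccontr)
    assume "\<not> 0 \<le> l"
    have "\<exists>x\<in>\<Omega>. max 0 (max 0 (U x) - l) < - l"
      by (rule H10_not_bounded_below[OF \<Omega>]) (use \<open>l \<in> L\<close> \<open>\<not> 0 \<le> l\<close> in \<open>simp_all add: L_def\<close>)
    then obtain x where "max 0 (max 0 (U x) - l) < - l" by blast
    then show False by (simp add: max_def split: if_splits)
  qed
  have "0 \<le> Inf (ereal ` L)" by (rule Inf_greatest) (auto simp: nonneg)
  with fin bs obtain M where M: "Inf (ereal ` L) = ereal M" "0 \<le> M"
    by (cases "Inf (ereal ` L)") auto
  have "\<exists>l\<in>L. l < M + inverse (real (Suc n))" for n
  proof -
    have "Inf (ereal ` L) < ereal (M + inverse (real (Suc n)))" by (simp add: M(1))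
    then show ?thesis by (auto simp: Inf_less_iff)
  qed
  then obtain l where l: "\<And>n. l n \<in> L" "\<And>n. l n < M + inverse (real (Suc n))" by metis
  have lM: "M \<le> l n" for n
    using Inf_lower[of "ereal (l n)" "ereal ` L"] l(1)[of n] M(1) by simp
  have "l \<longlonglongrightarrow> M"
  proof (rule tendsto_sandwich[OF _ _ tendsto_const])
    show "(\<lambda>n. M + inverse (real (Suc n))) \<longlonglongrightarrow> M"
      using tendsto_add[OF tendsto_const LIMSEQ_inverse_real_of_nat, of M] by simp
  qed (use lM l(2) in \<open>auto intro!: always_eventually less_imp_le\<close>)
  moreover have "(\<lambda>x. max 0 (U x - l n)) \<in> H10 \<Omega>" for n
  proof -
    have "(\<lambda>x. max 0 (max 0 (U x) - l n)) = (\<lambda>x. max 0 (U x - l n))"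
      using nonneg[OF l(1)[of n]] by auto
    then show ?thesis using l(1)[of n] by (simp add: L_def)
  qed
  ultimately have "(\<lambda>x. max 0 (U x - M)) \<in> H10 \<Omega>"
    by (intro positive_part_H10_limit[OF \<Omega>(1) U M(2) lM])
  with M bs that show thesis by simp
qed

text \<open>
  With \<open>w = max 0 (U - M)\<close> the gradients of \<open>w\<close> and of \<open>U - w = min U M\<close> are orthogonal, and
  \<open>(U - w) w = M w \<ge> 0\<close>. Hence the energy density of \<open>u - (U - w)\<close> exceeds that of
  \<open>u - U\<close> by at most twice the integrand of the subsolution inequality tested with \<open>w\<close>.
\<close>

lemma energy_norm_truncate_le:
  fixes u U c :: "'a::euclidean_space \<Rightarrow> real"
  assumes \<Omega>: "open \<Omega>"
    and c: "c \<in> Linfty \<Omega>" "AE x in lebesgue_on \<Omega>. 0 \<le> c x"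
    and u: "u \<in> H1 \<Omega>" and U: "U \<in> H1 \<Omega>" and M: "0 \<le> M"
    and sub: "(LINT x|lebesgue_on \<Omega>. weak_grad \<Omega> u x \<bullet> weak_grad \<Omega> (\<lambda>x. max 0 (U x - M)) x
      + c x * u x * max 0 (U x - M)) \<le> 0"
  shows "energy_norm \<Omega> c (\<lambda>x. u x - (U x - max 0 (U x - M))) \<le> energy_norm \<Omega> c (\<lambda>x. u x - U x)"
proof -
  obtain B where cm: "c \<in> borel_measurable (lebesgue_on \<Omega>)" and cB: "AE x in lebesgue_on \<Omega>. \<bar>c x\<bar> \<le> B"
    using c(1) by (auto simp: Linfty_def)
  note uL = H1_L2[OF u] and UL = H1_L2[OF U]
  define gu gU where "gu = weak_grad \<Omega> u" and "gU = weak_grad \<Omega> U"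
  have gu: "has_weak_gradient \<Omega> u gu" and gU: "has_weak_gradient \<Omega> U gU"
    unfolding gu_def gU_def by (rule H1_weak_grad[OF u] H1_weak_grad[OF U])+
  define w where "w x = max 0 (U x - M)" for x
  define gw where "gw x = indicator {x. M < U x} x *\<^sub>R gU x" for x
  have wL: "w \<in> L2 \<Omega>" unfolding w_def[abs_def] by (rule positive_part_L2[OF UL M])
  have gw: "has_weak_gradient \<Omega> w gw"
    unfolding w_def[abs_def] gw_def[abs_def] by (rule has_weak_gradient_positive_part[OF \<Omega> UL gU])
  have TL: "(\<lambda>x. U x - w x) \<in> L2 \<Omega>" by (rule L2_diff[OF UL wL])
  have gT: "has_weak_gradient \<Omega> (\<lambda>x. U x - w x) (\<lambda>x. gU x - gw x)"
    by (rule has_weak_gradient_diff[OF \<Omega> UL gU wL gw])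
  have DL: "(\<lambda>x. u x - (U x - w x)) \<in> L2 \<Omega>" by (rule L2_diff[OF uL TL])
  have gD: "has_weak_gradient \<Omega> (\<lambda>x. u x - (U x - w x)) (\<lambda>x. gu x - (gU x - gw x))"
    by (rule has_weak_gradient_diff[OF \<Omega> uL gu TL gT])
  have EL: "(\<lambda>x. u x - U x) \<in> L2 \<Omega>" by (rule L2_diff[OF uL UL])
  have gE: "has_weak_gradient \<Omega> (\<lambda>x. u x - U x) (\<lambda>x. gu x - gU x)"
    by (rule has_weak_gradient_diff[OF \<Omega> uL gu UL gU])
  have c_int: "integrable (lebesgue_on \<Omega>) (\<lambda>x. c x * f x * h x)" if "f \<in> L2 \<Omega>" "h \<in> L2 \<Omega>" for f h
    using L2_mult_integrable[OF L2_bounded_mult[OF that(1) cm cB] that(2)] by simp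
  have e_int: "integrable (lebesgue_on \<Omega>) (\<lambda>x. (norm (weak_grad \<Omega> f x))\<^sup>2 + c x * \<bar>f x\<bar>\<^sup>2)"
    if "f \<in> L2 \<Omega>" "has_weak_gradient \<Omega> f h" for f h
    using L2_integrable[OF has_weak_gradient_L2[OF H1_weak_grad[OF H1_I[OF that]]]] c_int[OF that(1,1)]
    by (simp add: power2_eq_square mult.assoc)
  define b where "b x = gu x \<bullet> weak_grad \<Omega> w x + c x * u x * w x" for x
  have b_int: "integrable (lebesgue_on \<Omega>) b"
    unfolding b_def[abs_def]
    by (intro Bochner_Integration.integrable_add c_int uL wL
        L2_inner_integrable[OF has_weak_gradient_L2[OF gu] has_weak_gradient_L2[OF H1_weak_grad[OF H1_I[OF wL gw]]]])
  have b_le: "(LINT x|lebesgue_on \<Omega>. b x) \<le> 0"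
    using sub by (simp add: b_def gu_def w_def[abs_def])
  define E where "E f x = (norm (weak_grad \<Omega> f x))\<^sup>2 + c x * \<bar>f x\<bar>\<^sup>2" for f x
  have ptw: "AE x in lebesgue_on \<Omega>. E (\<lambda>x. u x - (U x - w x)) x \<le> E (\<lambda>x. u x - U x) x + 2 * b x"
    using weak_grad_AE_eq[OF \<Omega> gw] weak_grad_AE_eq[OF \<Omega> gD] weak_grad_AE_eq[OF \<Omega> gE] c(2)
  proof eventually_elim
    case (elim x)
    have orth: "(gU x - gw x) \<bullet> gw x = 0" by (simp add: gw_def indicator_def)
    have "(norm (gu x - (gU x - gw x)))\<^sup>2 = (norm (gu x - gU x))\<^sup>2 + 2 * (gu x \<bullet> gw x)
        - 2 * ((gU x - gw x) \<bullet> gw x) - (norm (gw x))\<^sup>2"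
      unfolding power2_norm_eq_inner
      by (simp add: inner_diff_left inner_diff_right inner_commute[of "gw x" "gu x"]
          inner_commute[of "gw x" "gU x"] inner_commute[of "gU x" "gu x"] del: dot_square_norm)
    then have grad: "(norm (gu x - (gU x - gw x)))\<^sup>2 \<le> (norm (gu x - gU x))\<^sup>2 + 2 * (gu x \<bullet> gw x)"
      using orth by simp
    have Mw: "(U x - w x) * w x = M * w x" by (auto simp: w_def max_def)
    have w0: "0 \<le> w x" by (simp add: w_def)
    have "(u x - (U x - w x))\<^sup>2 = (u x - U x)\<^sup>2 + 2 * (u x * w x) - 2 * ((U x - w x) * w x) - (w x)\<^sup>2"
      by (simp add: power2_eq_square algebra_simps)
    moreover have "0 \<le> (U x - w x) * w x" unfolding Mw using M w0 by simp
    ultimately have "(u x - (U x - w x))\<^sup>2 \<le> (u x - U x)\<^sup>2 + 2 * (u x * w x)"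
      using zero_le_power2[of "w x"] by linarith
    from mult_left_mono[OF this elim(4)]
    have "c x * (u x - (U x - w x))\<^sup>2 \<le> c x * (u x - U x)\<^sup>2 + 2 * (c x * u x * w x)"
      by (simp only: distrib_left mult_ac)
    from add_mono[OF grad this] show ?case
      unfolding E_def b_def elim(1) elim(2) elim(3) power2_abs by (simp only: distrib_left add_ac)
  qed
  have "(LINT x|lebesgue_on \<Omega>. E (\<lambda>x. u x - (U x - w x)) x)
      \<le> (LINT x|lebesgue_on \<Omega>. E (\<lambda>x. u x - U x) x + 2 * b x)"
    unfolding E_def using e_int[OF DL gD] e_int[OF EL gE] b_int ptw
    by (intro integral_mono_AE) (auto simp: E_def)
  also have "\<dots> = (LINT x|lebesgue_on \<Omega>. E (\<lambda>x. u x - U x) x) + 2 * (LINT x|lebesgue_on \<Omega>. b x)"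
    using e_int[OF EL gE] b_int by (simp add: E_def)
  also have "\<dots> \<le> (LINT x|lebesgue_on \<Omega>. E (\<lambda>x. u x - U x) x)" using b_le by simp
  finally show ?thesis
    unfolding energy_norm_def E_def w_def by (rule real_sqrt_le_mono)
qed

theorem corollary2p2:
  fixes \<Omega> :: "(real ^ 'd) set"
    and c u U :: "real ^ 'd \<Rightarrow> real"
  assumes domain: "open \<Omega>" "connected \<Omega>" "\<Omega> \<noteq> {}" "bounded \<Omega>"
    and c: "c \<in> Linfty \<Omega>" "AE x in lebesgue_on \<Omega>. 0 \<le> c x"
    and u: "u \<in> H1 \<Omega>"
    and sub: "\<And>v. v \<in> H10 \<Omega> \<Longrightarrow> AE x in lebesgue_on \<Omega>. 0 \<le> v x \<Longrightarrow>
      (LINT x|lebesgue_on \<Omega>. weak_grad \<Omega> u x \<bullet> weak_grad \<Omega> v x + c x * u x * v x) \<le> 0"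
    and U: "U \<in> H1 \<Omega>"
    and bdry: "(\<lambda>x. U x - u x) \<in> H10 \<Omega>"
  shows "truncation \<Omega> U \<in> H1 \<Omega> \<and>
    (\<lambda>x. u x - truncation \<Omega> U x) \<in> H10 \<Omega> \<and>
    energy_norm \<Omega> c (\<lambda>x. u x - truncation \<Omega> U x) \<le> energy_norm \<Omega> c (\<lambda>x. u x - U x)"
proof (cases "boundary_sup \<Omega> (\<lambda>x. max 0 (U x)) = \<infinity>")
  case True
  then have "truncation \<Omega> U = U" by (simp add: truncation_def fun_eq_iff)
  then show ?thesis using U H10_uminus[OF domain(1) bdry] by simp
next
  case False
  obtain M where M: "0 \<le> M" "boundary_sup \<Omega> (\<lambda>x. max 0 (U x)) = ereal M"
    "(\<lambda>x. max 0 (U x - M)) \<in> H10 \<Omega>"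
    using boundary_sup_positive_part[OF domain(1,4,3) U False] .
  have T: "truncation \<Omega> U = (\<lambda>x. U x - max 0 (U x - M))"
  proof
    show "truncation \<Omega> U x = U x - max 0 (U x - M)" for x
      unfolding truncation_def M(2) by (simp add: min_def)
  qed
  have "(\<lambda>x. - (U x - u x) + max 0 (U x - M)) \<in> H10 \<Omega>"
    by (rule H10_add[OF domain(1) H10_uminus[OF domain(1) bdry] M(3)])
  moreover have "(\<lambda>x. - (U x - u x) + max 0 (U x - M)) = (\<lambda>x. u x - (U x - max 0 (U x - M)))"
    by auto
  ultimately have "(\<lambda>x. u x - (U x - max 0 (U x - M))) \<in> H10 \<Omega>" by (simp only:)
  moreover have "energy_norm \<Omega> c (\<lambda>x. u x - (U x - max 0 (U x - M))) \<le> energy_norm \<Omega> c (\<lambda>x. u x - U x)"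
    by (rule energy_norm_truncate_le[OF domain(1) c u U M(1) sub[OF M(3)]]) simp
  ultimately show ?thesis unfolding T using H1_diff[OF domain(1) U H10_H1[OF M(3)]] by blast
qed

end
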